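(* Let $\Delta=\operatorname{conv}(v_0,\dots,v_d)$ be a $d$-dimensional lattice simplex possessing the integer decomposition property. (1) If every nonzero element of the coordinate group $\Lambda_\Delta$ has full support (i.e. $\operatorname{supp}(\lambda)=\{0,\dots,d\}$ for every $0\ne\lambda\in\Lambda_\Delta$), then the $h^*$-vector of $\Delta$ is unimodal. (2) Suppose $\operatorname{Vol}(\Delta)>1$, and let $F=\Delta_I=\operatorname{conv}(v_i\mid i\in I)$ be the support face of $\Delta$, where $I=\bigcup_{\lambda\in\Lambda_\Delta}\operatorname{supp}(\lambda)$. If every nonzero element of $\Lambda_F$ has full support (i.e. support equal to $I$), then the $h^*$-vector of $\Delta$ is unimodal.
   Context: A lattice $M$ is a free abelian group of finite rank, and $M_{\mathbb{R}}=M\otimes_{\mathbb{Z}}\mathbb{R}$. A lattice polytope $P\subset M_{\mathbb{R}}$ is the convex hull of a finite set of points of $M$; a $d$-dimensional lattice polytope with exactly $d+1$ vertices is a lattice simplex. Integer decomposition property (IDP): for every positive integer $n$, every $z\in nP\cap M$ can be written $z=z_1+\cdots+z_n$ with all $z_i\in P\cap M$. Normalized volume: with $v\in P\cap M$ and $M_P=M\cap\operatorname{span}_{\mathbb{R}}(P-v)$, $\operatorname{Vol}(P)$ is $d!$ times the $d$-dimensional volume of $P-v$ in $\operatorname{span}_{\mathbb{R}}(P-v)$, normalized so that a fundamental parallelepiped of $M_P$ has volume one (a single lattice point has normalized volume one). $h^*$-vector: $\sum_{n\ge 0}|nP\cap M|t^n=h^*_P(t)/(1-t)^{d+1}$ with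 $h_P^*(t)=\sum_{i=0}^d h_i^*(P)t^i$ and $d=\dim P$; the $h^*$-vector is $(h_0^*(P),\dots,h_d^*(P))$, terminal zeros retained. A finite sequence $(a_0,\dots,a_d)$ is unimodal if there is $k$ with $a_0\le\cdots\le a_k\ge\cdots\ge a_d$. Coordinate group: for a $d$-dimensional lattice simplex $\Delta=\operatorname{conv}(v_0,\dots,v_d)$, let $w_j=(v_j,1)\in M\oplus\mathbb{Z}$, let $C_\Delta=\mathbb{R}_{\ge0}(\Delta\times\{1\})$, $N_\Delta=\operatorname{span}_{\mathbb{R}}(C_\Delta)\cap(M\oplus\mathbb{Z})$, and let $W:\mathbb{R}^{d+1}\to\operatorname{span}_{\mathbb{R}}(C_\Delta)$, $W(\lambda)=\sum_{j=0}^d\lambda_jw_j$ (a linear isomorphism). Define $$\Lambda_\Delta=\{\lambda\in[0,1)^{d+1}\mid W(\lambda)\in N_\Delta\},$$ an abelian group under coordinatewise addition modulo $1$. For $\lambda=(\lambda_0,\dots,\lambda_d)\in\Lambda_\Delta$, $\operatorname{supp}(\lambda)=\{j\mid\lambda_j\ne0\}$. For a face $\Delta_I=\operatorname{conv}(v_i\mid i\in I)$ with $\emptyset\neq I\subseteq\{0,\dots,d\}$, $\Lambda_{\Delta_I}$ is defined in the same way from the vertices $v_i$, $i\in I$, with coordinates indexed by $I$. *)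

theory Defs
  imports
    "HOL-Analysis.Analysis"
    "HOL-Algebra.Group"
    "HOL-Computational_Algebra.Polynomial_FPS"
begin

text \<open>
  A lattice is realised as the set of integral combinations of finitely many linearly independent
  vectors of an ambient Euclidean space. Every free abelian group \<open>M\<close> of finite rank (rank zero
  included) occurs in this way, and \<open>span M\<close> is then \<open>M \<otimes> \<real>\<close>.
\<close>

definition lattice_basis :: "'a::euclidean_space set \<Rightarrow> 'a set \<Rightarrow> bool" where
  "lattice_basis B L \<longleftrightarrow> finite B \<and> independent B \<and>
     L = {(\<Sum>b\<in>B. real_of_int (c b) *\<^sub>R b) | c :: 'a \<Rightarrow> int. True}"

definition is_lattice :: "'a::euclidean_space set \<Rightarrow> bool" where
  "is_lattice L \<longleftrightarrow> (\<exists>B. lattice_basis B L)"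

definition lattice_polytope :: "'a::euclidean_space set \<Rightarrow> 'a set \<Rightarrow> bool" where
  "lattice_polytope M P \<longleftrightarrow> (\<exists>S. finite S \<and> S \<subseteq> M \<and> P = convex hull S)"

definition lattice_simplex :: "'a::euclidean_space set \<Rightarrow> nat \<Rightarrow> 'a set \<Rightarrow> bool" where
  "lattice_simplex M d P \<longleftrightarrow> lattice_polytope M P \<and> int d simplex P"

definition dilate :: "nat \<Rightarrow> 'a::euclidean_space set \<Rightarrow> 'a set" where
  "dilate n P = (\<lambda>x. real n *\<^sub>R x) ` P"

definition IDP :: "'a::euclidean_space set \<Rightarrow> 'a set \<Rightarrow> bool" where
  "IDP M P \<longleftrightarrow> (\<forall>n>0. \<forall>z \<in> dilate n P \<inter> M.
     \<exists>w :: nat \<Rightarrow> 'a. (\<forall>i<n. w i \<in> P \<inter> M) \<and> z = (\<Sum>i<n. w i))"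

text \<open>
  The volume on \<open>span (P - v)\<close>, normalised by \<open>M_P\<close>, is Lebesgue measure in the coordinates given
  by a lattice basis \<open>B\<close> of \<open>M_P\<close>: this maps the fundamental parallelepiped spanned by \<open>B\<close> to the
  unit cube. Neither the choice of \<open>B\<close> nor that of \<open>v\<close> affects the value.
\<close>

definition relative_lattice :: "'a::euclidean_space set \<Rightarrow> 'a set \<Rightarrow> 'a \<Rightarrow> 'a set" where
  "relative_lattice M P v = M \<inter> span ((\<lambda>x. x - v) ` P)"

definition normalized_volume :: "'a::euclidean_space set \<Rightarrow> 'a set \<Rightarrow> real" where
  "normalized_volume M P =
     (let v = (SOME v. v \<in> P \<inter> M);
          B = (SOME B. lattice_basis B (relative_lattice M P v))
      in fact (nat (aff_dim P)) *
         measure (Pi\<^sub>M B (\<lambda>_. lborel))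
           {x \<in> B \<rightarrow>\<^sub>E UNIV. (\<Sum>b\<in>B. x b *\<^sub>R b) \<in> (\<lambda>y. y - v) ` P})"

definition ehrhart_series :: "'a::euclidean_space set \<Rightarrow> 'a set \<Rightarrow> rat fps" where
  "ehrhart_series M P = Abs_fps (\<lambda>n. of_nat (card (dilate n P \<inter> M)))"

definition is_hstar_poly :: "'a::euclidean_space set \<Rightarrow> 'a set \<Rightarrow> rat poly \<Rightarrow> bool" where
  "is_hstar_poly M P h \<longleftrightarrow> degree h \<le> nat (aff_dim P) \<and>
     ehrhart_series M P = fps_of_poly h / (1 - fps_X) ^ (nat (aff_dim P) + 1)"

definition hstar_poly :: "'a::euclidean_space set \<Rightarrow> 'a set \<Rightarrow> rat poly" where
  "hstar_poly M P = (THE h. is_hstar_poly M P h)"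

lemma hstar_poly_eqI:
  assumes "is_hstar_poly M P h"
  shows "hstar_poly M P = h"
  unfolding hstar_poly_def
proof (rule the_equality)
  fix g assume g: "is_hstar_poly M P g"
  define D :: "rat fps" where "D = (1 - fps_X) ^ (nat (aff_dim P) + 1)"
  have D: "fps_nth D 0 \<noteq> 0" "D \<noteq> 0" by (auto simp: D_def fps_nth_power_0)
  have "fps_of_poly g / D = fps_of_poly h / D"
    using assms g by (simp add: is_hstar_poly_def D_def)
  hence "fps_of_poly g * inverse D = fps_of_poly h * inverse D"
    using D by (simp add: fps_divide_unit)
  hence "fps_of_poly g = fps_of_poly h"
    using D by simp
  thus "g = h" by simp
qed (rule assms)

definition hstar_vector :: "'a::euclidean_space set \<Rightarrow> 'a set \<Rightarrow> rat list" where
  "hstar_vector M P = map (coeff (hstar_poly M P)) [0..<nat (aff_dim P) + 1]"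

definition unimodal :: "'b::linorder list \<Rightarrow> bool" where
  "unimodal a \<longleftrightarrow> (\<exists>k<length a.
     (\<forall>i<k. a ! i \<le> a ! Suc i) \<and>
     (\<forall>i. k \<le> i \<and> Suc i < length a \<longrightarrow> a ! Suc i \<le> a ! i))"

text \<open>
  In the following, \<open>v\<close> is a family of affinely independent points of \<open>M\<close> and \<open>I\<close> a finite set of
  indices; the full simplex is the case \<open>I = {0..d}\<close>, its faces are the cases \<open>I \<subseteq> {0..d}\<close>.
  Coordinate vectors indexed by \<open>I\<close> are functions that are \<open>undefined\<close> outside \<open>I\<close>, hence the
  explicit index set in \<open>coord_supp\<close>.
\<close>

definition face :: "(nat \<Rightarrow> 'a::euclidean_space) \<Rightarrow> nat set \<Rightarrow> 'a set" where
  "face v I = convex hull (v ` I)"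

definition cone_over :: "'a::euclidean_space set \<Rightarrow> ('a \<times> real) set" where
  "cone_over P = cone hull (P \<times> {1})"

definition cone_lattice :: "'a::euclidean_space set \<Rightarrow> 'a set \<Rightarrow> ('a \<times> real) set" where
  "cone_lattice M P = span (cone_over P) \<inter> (M \<times> \<int>)"

definition coord_map ::
  "(nat \<Rightarrow> 'a::euclidean_space) \<Rightarrow> nat set \<Rightarrow> (nat \<Rightarrow> real) \<Rightarrow> 'a \<times> real" where
  "coord_map v I x = (\<Sum>j\<in>I. x j *\<^sub>R (v j, 1))"

definition coord_group ::
  "'a::euclidean_space set \<Rightarrow> (nat \<Rightarrow> 'a) \<Rightarrow> nat set \<Rightarrow> (nat \<Rightarrow> real) monoid" where
  "coord_group M v I =
     \<lparr>carrier = {x \<in> I \<rightarrow>\<^sub>E {0..<1}. coord_map v I x \<in> cone_lattice M (face v I)},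
      mult = (\<lambda>x y. \<lambda>j\<in>I. frac (x j + y j)),
      one = (\<lambda>j\<in>I. 0)\<rparr>"

lemma is_lattice_add: "is_lattice L \<Longrightarrow> x \<in> L \<Longrightarrow> y \<in> L \<Longrightarrow> x + y \<in> L"
  unfolding is_lattice_def lattice_basis_def
proof clarsimp
  fix B :: "'a set" and c c' :: "'a \<Rightarrow> int"
  show "\<exists>c''. (\<Sum>b\<in>B. of_int (c b) *\<^sub>R b) + (\<Sum>b\<in>B. of_int (c' b) *\<^sub>R b) =
          (\<Sum>b\<in>B. of_int (c'' b) *\<^sub>R b)"
    by (rule exI[of _ "\<lambda>b. c b + c' b"]) (simp add: scaleR_add_left sum.distrib)
qed

lemma is_lattice_scale: "is_lattice L \<Longrightarrow> x \<in> L \<Longrightarrow> of_int k *\<^sub>R x \<in> L"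
  unfolding is_lattice_def lattice_basis_def
proof clarsimp
  fix B :: "'a set" and c :: "'a \<Rightarrow> int"
  show "\<exists>c''. of_int k *\<^sub>R (\<Sum>b\<in>B. of_int (c b) *\<^sub>R b) = (\<Sum>b\<in>B. of_int (c'' b) *\<^sub>R b)"
    by (rule exI[of _ "\<lambda>b. k * c b"]) (simp add: scaleR_sum_right)
qed

lemma is_lattice_zero:
  assumes "is_lattice L"
  shows "(0::'a::euclidean_space) \<in> L"
proof -
  obtain B where B: "L = {(\<Sum>b\<in>B. of_int (c b) *\<^sub>R b) | c :: 'a \<Rightarrow> int. True}"
    using assms by (auto simp: is_lattice_def lattice_basis_def)
  show ?thesis
    unfolding B by (rule CollectI, rule exI[of _ "\<lambda>_. 0"]) simp
qed

lemma cone_lattice_closed: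
  assumes "is_lattice M"
  shows "0 \<in> cone_lattice M P"
    and "p \<in> cone_lattice M P \<Longrightarrow> q \<in> cone_lattice M P \<Longrightarrow> p + q \<in> cone_lattice M P"
    and "p \<in> cone_lattice M P \<Longrightarrow> of_int k *\<^sub>R p \<in> cone_lattice M P"
  using is_lattice_zero[OF assms] is_lattice_add[OF assms] is_lattice_scale[OF assms]
  by (auto simp: cone_lattice_def span_add span_scale
      span_zero[of "cone_over P", unfolded zero_prod_def] zero_prod_def)

lemma coord_map_in_cone_lattice_mod_1:
  assumes M: "is_lattice M" and I: "finite I" "v ` I \<subseteq> M"
    and p: "coord_map v I x \<in> cone_lattice M (face v I)"
    and xy: "\<And>j. j \<in> I \<Longrightarrow> y j = x j + of_int (k j)"
  shows "coord_map v I y \<in> cone_lattice M (face v I)"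
proof -
  let ?N = "cone_lattice M (face v I)"
  have gen: "(v j, 1) \<in> ?N" if "j \<in> I" for j
    using that I by (auto simp: cone_lattice_def cone_over_def face_def
        intro!: span_base hull_inc)
  have "(\<Sum>j\<in>J. of_int (k j) *\<^sub>R (v j, 1)) \<in> ?N" if "J \<subseteq> I" for J
    using finite_subset[OF that I(1)] that
    by (induction J rule: finite_induct)
       (auto intro!: cone_lattice_closed[OF M] gen simp del: scaleR_Pair)
  moreover have "coord_map v I y = coord_map v I x + (\<Sum>j\<in>I. of_int (k j) *\<^sub>R (v j, 1))"
    unfolding coord_map_def sum.distrib[symmetric]
    by (rule sum.cong) (simp_all add: xy scaleR_add_left)
  ultimately show ?thesis
    using p cone_lattice_closed(2)[OF M] by auto
qed

lemma coord_group_is_comm_group: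
  assumes M: "is_lattice M" and I: "finite I" "v ` I \<subseteq> M"
  shows "comm_group (coord_group M v I)"
proof (rule comm_groupI)
  let ?G = "coord_group M v I"
  note mod1 = coord_map_in_cone_lattice_mod_1[OF M I]
  fix x y assume x: "x \<in> carrier ?G" and y: "y \<in> carrier ?G"
  have add: "coord_map v I (\<lambda>j. x j + y j) \<in> cone_lattice M (face v I)"
    using x y cone_lattice_closed(2)[OF M, of "coord_map v I x" _ "coord_map v I y"]
    by (simp add: coord_group_def coord_map_def sum.distrib scaleR_add_left
        flip: sum.distrib del: scaleR_Pair)
  have "coord_map v I (\<lambda>j\<in>I. frac (x j + y j)) \<in> cone_lattice M (face v I)"
    by (rule mod1[OF add, where k = "\<lambda>j. - \<lfloor>x j + y j\<rfloor>"]) (simp add: frac_def)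
  then show "x \<otimes>\<^bsub>?G\<^esub> y \<in> carrier ?G"
    by (auto simp: coord_group_def frac_lt_1)
  show "x \<otimes>\<^bsub>?G\<^esub> y = y \<otimes>\<^bsub>?G\<^esub> x"
    by (simp add: coord_group_def add.commute)
next
  let ?G = "coord_group M v I"
  show "\<one>\<^bsub>?G\<^esub> \<in> carrier ?G"
    using cone_lattice_closed(1)[OF M]
    by (auto simp: coord_group_def coord_map_def simp flip: zero_prod_def)
next
  let ?G = "coord_group M v I"
  fix x y z assume "x \<in> carrier ?G" "y \<in> carrier ?G" "z \<in> carrier ?G"
  have "frac (frac a + b) = frac (a + b)" "frac (b + frac a) = frac (b + a)" for a b :: real
    by (simp_all add: frac_def floor_add_int floor_diff_of_int algebra_simps)
  then show "x \<otimes>\<^bsub>?G\<^esub> y \<otimes>\<^bsub>?G\<^esub> z = x \<otimes>\<^bsub>?G\<^esub> (y \<otimes>\<^bsub>?G\<^esub> z)"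
    by (auto simp: coord_group_def fun_eq_iff add.assoc)
next
  let ?G = "coord_group M v I"
  note mod1 = coord_map_in_cone_lattice_mod_1[OF M I]
  fix x assume x: "x \<in> carrier ?G"
  have *: "frac (x j) = x j" if "j \<in> I" for j
    using x that by (auto simp: coord_group_def frac_eq PiE_iff)
  show "\<one>\<^bsub>?G\<^esub> \<otimes>\<^bsub>?G\<^esub> x = x"
    using x * by (auto simp: coord_group_def fun_eq_iff PiE_iff extensional_def)
  have neg: "coord_map v I (\<lambda>j. - x j) \<in> cone_lattice M (face v I)"
    using x cone_lattice_closed(3)[OF M, of "coord_map v I x" _ "-1"]
    by (simp add: coord_group_def coord_map_def flip: sum_negf)
  have "coord_map v I (\<lambda>j\<in>I. frac (- x j)) \<in> cone_lattice M (face v I)"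
    by (rule mod1[OF neg, where k = "\<lambda>j. - \<lfloor>- x j\<rfloor>"]) (simp add: frac_def)
  hence "(\<lambda>j\<in>I. frac (- x j)) \<in> carrier ?G"
    by (auto simp: coord_group_def frac_lt_1)
  moreover have "(\<lambda>j\<in>I. frac (- x j)) \<otimes>\<^bsub>?G\<^esub> x = \<one>\<^bsub>?G\<^esub>"
    by (auto simp: coord_group_def fun_eq_iff frac_def)
  ultimately show "\<exists>y\<in>carrier ?G. y \<otimes>\<^bsub>?G\<^esub> x = \<one>\<^bsub>?G\<^esub>" by blast
qed

definition coord_supp :: "nat set \<Rightarrow> (nat \<Rightarrow> real) \<Rightarrow> nat set" where
  "coord_supp I x = {j \<in> I. x j \<noteq> 0}"

definition full_support ::
  "'a::euclidean_space set \<Rightarrow> (nat \<Rightarrow> 'a) \<Rightarrow> nat set \<Rightarrow> bool" where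
  "full_support M v I \<longleftrightarrow>
     (\<forall>x \<in> carrier (coord_group M v I). x \<noteq> \<one>\<^bsub>coord_group M v I\<^esub> \<longrightarrow> coord_supp I x = I)"

definition support_indices ::
  "'a::euclidean_space set \<Rightarrow> (nat \<Rightarrow> 'a) \<Rightarrow> nat set \<Rightarrow> nat set" where
  "support_indices M v I = (\<Union>x \<in> carrier (coord_group M v I). coord_supp I x)"

end

theory Submission
  imports Defs "HOL-Library.Poly_Mapping" "HOL-Library.Z2"
begin

text \<open>
  The $h^*$-vector counts the lattice points of the half-open box spanned by the $(v_j, 1)$ by height.
  In both parts all nonzero box points have the same support \<open>J\<close>. Hence $p \mapsto \sigma - p$, where
  $\sigma$ is the sum of the $(v_j, 1)$ with $j \in J$, makes the vector symmetric around $|J|/2$,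
  apart from $h^*_0 = 1$, and it remains to show that it increases up to the middle.

  This is a Lefschetz argument in characteristic 2, following the anisotropy method of Adiprasito,
  Papadakis and Petrotou. Perturb the monomials $t^{w_j}$ to linear forms $\theta_j$ with generic
  coefficients, add further generic linear forms $\ell_1, \dots, \ell_m$ with $m = |J| - 2i$, and let
  $\varphi(f)$ be the constant term of $f / \prod_j \theta_j$. If $h^*_{i+1} < h^*_i$, then some nonzero
  combination $u$ of box points of height $i$ has
  $\varphi(u^2 \prod_k \ell_k) = \varphi'(\prod_j \theta_j \prod_k \ell_k \, R^2) = 0$, where
  $R = u / \prod_j \theta_j$ and $\varphi'$ is the constant term. Derivations with respect to the generic
  coefficients kill $R^2$, so every product of $|J| + m$ monomials of height 1 can be substituted for the
  linear forms. Taking each factor of $t^\gamma$ twice gives $\varphi(u t^\gamma)^2 = 0$; by the integer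
  decomposition property this holds for every box point $\gamma$ of height $|J| - i$. Modulo the
  perturbation these values are the coefficients of $u$, so $u = 0$.
\<close>

section \<open>Laurent polynomials in characteristic 2\<close>

abbreviation "lookup \<equiv> poly_mapping.lookup"

lemma sum_single_lookup:
  "(\<Sum>k\<in>Poly_Mapping.keys f. Poly_Mapping.single k (lookup f k)) = f"
proof (rule poly_mapping_eqI)
  fix z
  have "lookup (\<Sum>k\<in>Poly_Mapping.keys f. Poly_Mapping.single k (lookup f k)) z
      = (\<Sum>k\<in>Poly_Mapping.keys f. if k = z then lookup f k else 0)"
    by (simp add: lookup_sum lookup_single when_def)
  also have "\<dots> = lookup f z"
    by (simp add: in_keys_iff)
  finally show "lookup (\<Sum>k\<in>Poly_Mapping.keys f. Poly_Mapping.single k (lookup f k)) z = lookup f z" .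
qed

lemma poly_mapping_additive_induct [case_names zero single add]:
  fixes f :: "'k \<Rightarrow>\<^sub>0 'c::comm_monoid_add"
  assumes "Q 0" "\<And>k c. Q (Poly_Mapping.single k c)" "\<And>f g. Q f \<Longrightarrow> Q g \<Longrightarrow> Q (f + g)"
  shows "Q f"
proof -
  have "Q (\<Sum>k\<in>S. Poly_Mapping.single k (lookup f k))" if "finite S" for S
    using that by (induction S rule: finite_induct) (auto intro: assms)
  from this[of "Poly_Mapping.keys f"] show ?thesis by (simp add: sum_single_lookup)
qed

lemma lookup_single_mult:
  fixes f :: "'k::ab_group_add \<Rightarrow>\<^sub>0 'c::comm_ring_1"
  shows "lookup (Poly_Mapping.single k c * f) z = c * lookup f (z - k)"
proof (induction f rule: poly_mapping_additive_induct)
  case (single l d)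
  have "k + l = z \<longleftrightarrow> l = z - k" by (auto simp: algebra_simps)
  then show ?case by (simp add: mult_single lookup_single when_def)
qed (simp_all add: lookup_add algebra_simps)

text \<open>In characteristic 2 squaring is additive, so single terms suffice. The hypothesis
  \<open>double\<close> ensures that only the exponent \<open>z\<close> contributes at
  \<open>z + z\<close>.\<close>

lemma lookup_square_char2:
  fixes f :: "'k::comm_monoid_add \<Rightarrow>\<^sub>0 'c::comm_ring_1"
  assumes char2: "\<And>c::'c. c + c = 0" and double: "\<And>x y::'k. x + x = y + y \<Longrightarrow> x = y"
  shows "lookup (f * f) (z + z) = lookup f z * lookup f z"
proof -
  have tw: "g + g = 0" for g :: "'k \<Rightarrow>\<^sub>0 'c"
    by (rule poly_mapping_eqI) (simp only: lookup_add char2 lookup_zero)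
  have sq: "(f + g) * (f + g) = f * f + g * g" for f g :: "'k \<Rightarrow>\<^sub>0 'c"
  proof -
    have "(f + g) * (f + g) = f * f + g * g + (f * g + f * g)" by (simp add: algebra_simps)
    then show ?thesis by (simp only: tw add.right_neutral)
  qed
  have sqc: "(a + b) * (a + b) = a * a + b * b" for a b :: 'c
  proof -
    have "(a + b) * (a + b) = a * a + b * b + (a * b + a * b)" by (simp add: algebra_simps)
    then show ?thesis by (simp only: char2 add.right_neutral)
  qed
  show "lookup (f * f) (z + z) = lookup f z * lookup f z"
  proof (induction f rule: poly_mapping_additive_induct)
    case (single k c)
    then show ?case by (auto simp: mult_single lookup_single when_def dest: double)
  qed (simp_all add: sq sqc lookup_add)
qed

section \<open>Derivations that act coefficient by coefficient\<close>

definition coefwise :: "('k \<Rightarrow> 'c \<Rightarrow> 'c::comm_ring_1) \<Rightarrow> ('k::comm_monoid_add \<Rightarrow>\<^sub>0 'c) \<Rightarrow> ('k \<Rightarrow>\<^sub>0 'c)" where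
  "coefwise \<delta> f = Poly_Mapping.mapp \<delta> f"

text \<open>The map may depend on the exponent. This covers both \<open>X d/dX\<close>, which
  multiplies by an exponent, and the lift of a derivation of the coefficient ring, which ignores the
  exponent.\<close>

locale coef_derivation =
  fixes \<delta> :: "'k::comm_monoid_add \<Rightarrow> 'c::comm_ring_1 \<Rightarrow> 'c"
  assumes add: "\<delta> k (a + b) = \<delta> k a + \<delta> k b"
    and leibniz: "\<delta> (k + l) (a * b) = \<delta> k a * b + a * \<delta> l b"
begin

lemma zero [simp]: "\<delta> k 0 = 0"
  using add[of k 0 0] by simp

lemma lookup_coefwise: "lookup (coefwise \<delta> f) k = \<delta> k (lookup f k)"
  by (auto simp: coefwise_def lookup_mapp when_def in_keys_iff)

lemma coefwise_add: "coefwise \<delta> (f + g) = coefwise \<delta> f + coefwise \<delta> g"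
  by (rule poly_mapping_eqI) (simp add: lookup_coefwise lookup_add add)

lemma coefwise_zero [simp]: "coefwise \<delta> 0 = 0"
  by (rule poly_mapping_eqI) (simp add: lookup_coefwise)

lemma coefwise_single: "coefwise \<delta> (Poly_Mapping.single k c) = Poly_Mapping.single k (\<delta> k c)"
  by (rule poly_mapping_eqI) (simp add: lookup_coefwise lookup_single when_def)

lemma coefwise_mult: "coefwise \<delta> (f * g) = coefwise \<delta> f * g + f * coefwise \<delta> g"
proof (induction f rule: poly_mapping_additive_induct)
  case (single k a)
  show ?case
  proof (induction g rule: poly_mapping_additive_induct)
    case (single l b)
    show ?case by (simp add: mult_single coefwise_single leibniz single_add)
  qed (simp_all add: coefwise_add algebra_simps)
qed (simp_all add: coefwise_add algebra_simps)

end

unbundle no vec_syntax and fps_syntax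

text \<open>The terms at \<open>i\<close> and \<open>n - i\<close> agree and cancel in
  characteristic 2; only the middle term of an even \<open>n\<close> survives.\<close>

lemma fps_square_nth_char2:
  fixes f :: "'r::comm_ring_1 fps"
  assumes char2: "\<And>c::'r. c + c = 0"
  shows "(f * f) $ n = (if even n then f $ (n div 2) * f $ (n div 2) else 0)"
proof -
  let ?g = "\<lambda>i. f $ i * f $ (n - i)"
  have "{0..n} = {i. 2 * i < n} \<union> {i. i \<le> n \<and> n < 2 * i} \<union> {i. 2 * i = n}" by auto
  then have "(f * f) $ n = sum ?g ({i. 2 * i < n} \<union> {i. i \<le> n \<and> n < 2 * i} \<union> {i. 2 * i = n})"
    by (simp only: fps_mult_nth)
  also have "\<dots> = sum ?g {i. 2 * i < n} + sum ?g {i. i \<le> n \<and> n < 2 * i} + sum ?g {i. 2 * i = n}"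
  proof -
    have fin: "finite {i. 2 * i < n}" "finite {i. i \<le> n \<and> n < 2 * i}" "finite {i. 2 * i = n}"
      by (auto intro: finite_subset[of _ "{..n}"])
    then show ?thesis by (subst sum.union_disjoint | force)+
  qed
  also have "sum ?g {i. i \<le> n \<and> n < 2 * i} = sum ?g {i. 2 * i < n}"
    by (rule sum.reindex_bij_witness[of _ "\<lambda>i. n - i" "\<lambda>i. n - i"]) (auto simp: mult.commute)
  also have "sum ?g {i. 2 * i = n} = (if even n then f $ (n div 2) * f $ (n div 2) else 0)"
  proof (cases "even n")
    case True
    then have "{i. 2 * i = n} = {n div 2}" "n - n div 2 = n div 2" by auto
    then show ?thesis using True by simp
  next
    case False
    then have "{i. 2 * i = n} = {}" by auto
    then show ?thesis using False by simp
  qed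
  finally show ?thesis by (simp only: char2 add.left_neutral)
qed

text \<open>
  Power series in an auxiliary variable over Laurent polynomials: a perturbation of a monomial that
  vanishes with the auxiliary variable is invertible there.
\<close>

definition lmonom :: "'g::ab_group_add \<Rightarrow> ('g \<Rightarrow>\<^sub>0 'c::comm_ring_1) fps" where
  "lmonom z = fps_const (Poly_Mapping.single z 1)"

definition scalar :: "'c::comm_ring_1 fps \<Rightarrow> ('g::ab_group_add \<Rightarrow>\<^sub>0 'c) fps" where
  "scalar c = Abs_fps (\<lambda>n. Poly_Mapping.single 0 (c $ n))"

definition coef :: "'g::ab_group_add \<Rightarrow> ('g \<Rightarrow>\<^sub>0 'c::comm_ring_1) fps \<Rightarrow> 'c fps" where
  "coef z f = Abs_fps (\<lambda>n. lookup (f $ n) z)"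

lemma lmonom_0 [simp]: "lmonom 0 = 1"
  by (simp add: lmonom_def single_one)

lemma lmonom_mult: "lmonom y * lmonom z = lmonom (y + z)"
  by (simp add: lmonom_def mult_single fps_const_mult)

lemma lmonom_prod: "(\<Prod>i\<in>S. lmonom (w i)) = lmonom (\<Sum>i\<in>S. w i)"
  by (induction S rule: infinite_finite_induct) (simp_all add: lmonom_mult)

lemma single_sum: "Poly_Mapping.single k (\<Sum>i\<in>S. h i) = (\<Sum>i\<in>S. Poly_Mapping.single k (h i))"
  by (induction S rule: infinite_finite_induct) (simp_all add: single_add)

lemma scalar_mult: "scalar (b * c) = scalar b * scalar c"
  by (rule fps_ext) (simp add: scalar_def fps_mult_nth mult_single single_sum)

lemma scalar_1 [simp]: "scalar 1 = 1"
  by (rule fps_ext) (simp add: scalar_def single_one)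

lemma scalar_0: "scalar 0 = 0"
  by (rule fps_ext) (simp add: scalar_def)

lemma scalar_prod: "scalar (\<Prod>i\<in>S. c i) = (\<Prod>i\<in>S. scalar (c i))"
  by (induction S rule: infinite_finite_induct) (simp_all add: scalar_mult)

lemma coef_add: "coef z (f + g) = coef z f + coef z g"
  by (rule fps_ext) (simp add: coef_def lookup_add)

lemma coef_0 [simp]: "coef z 0 = 0"
  by (rule fps_ext) (simp add: coef_def)

lemma coef_sum: "coef z (\<Sum>i\<in>S. f i) = (\<Sum>i\<in>S. coef z (f i))"
  by (induction S rule: infinite_finite_induct) (simp_all add: coef_add)

lemma coef_lmonom_mult: "coef z (lmonom y * f) = coef (z - y) f"
  by (rule fps_ext) (simp add: coef_def lmonom_def fps_mult_left_const_nth lookup_single_mult)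

lemma coef_scalar_mult: "coef z (scalar c * f) = c * coef z f"
  by (rule fps_ext) (simp add: coef_def scalar_def fps_mult_nth lookup_sum lookup_single_mult)

text \<open>Constant terms are later shown to vanish by confining all exponents to a half-space that
  misses 0.\<close>

definition supported :: "'g set \<Rightarrow> ('g::ab_group_add \<Rightarrow>\<^sub>0 'c::comm_ring_1) fps \<Rightarrow> bool" where
  "supported S f \<longleftrightarrow> (\<forall>n. Poly_Mapping.keys (f $ n) \<subseteq> S)"

lemma supported_add: "supported S f \<Longrightarrow> supported S g \<Longrightarrow> supported S (f + g)"
  using keys_add by (fastforce simp: supported_def)

lemma supported_0: "supported S 0"
  by (simp add: supported_def)

lemma supported_sum: "(\<And>i. i \<in> A \<Longrightarrow> supported S (f i)) \<Longrightarrow> supported S (\<Sum>i\<in>A. f i)"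
  by (induction A rule: infinite_finite_induct) (simp_all add: supported_add supported_0)

lemma keys_sum_subset:
  "(\<And>i. i \<in> A \<Longrightarrow> Poly_Mapping.keys (f i) \<subseteq> S) \<Longrightarrow> Poly_Mapping.keys (\<Sum>i\<in>A. f i) \<subseteq> S"
  by (induction A rule: infinite_finite_induct) (use keys_add in fastforce)+

lemma supported_mult:
  assumes "supported S f" "supported T g" "\<And>y z. y \<in> S \<Longrightarrow> z \<in> T \<Longrightarrow> y + z \<in> U"
  shows "supported U (f * g)"
  unfolding supported_def fps_mult_nth
proof (intro allI keys_sum_subset)
  fix n i
  show "Poly_Mapping.keys (f $ i * g $ (n - i)) \<subseteq> U"
    using keys_mult[of "f $ i" "g $ (n - i)"] assms by (fastforce simp: supported_def)
qed

lemma supported_lmonom: "z \<in> S \<Longrightarrow> supported S (lmonom z)"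
  by (auto simp: supported_def lmonom_def)

lemma supported_scalar: "supported {0} (scalar c)"
  by (auto simp: supported_def scalar_def)

lemma supported_scalar_mult: "supported S f \<Longrightarrow> supported S (scalar c * f)"
  by (rule supported_mult[OF supported_scalar]) auto

lemma coef_eq_0_if_supported: "supported S f \<Longrightarrow> z \<notin> S \<Longrightarrow> coef z f = 0"
  by (rule fps_ext) (simp add: supported_def coef_def, meson not_in_keys_iff_lookup_eq_zero subsetD)

text \<open>Gaussian elimination without division, because the entries will be power series rather
  than elements of a field.\<close>

lemma underdetermined_system:
  fixes m :: "'j \<Rightarrow> 'i \<Rightarrow> 'r::idom"
  assumes "finite J" "finite I" "card J < card I"
  shows "\<exists>u. (\<exists>i\<in>I. u i \<noteq> 0) \<and> (\<forall>j\<in>J. (\<Sum>i\<in>I. m j i * u i) = 0)"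
  using assms
proof (induction J arbitrary: I m rule: finite_induct)
  case empty
  then obtain i where "i \<in> I" by fastforce
  then show ?case by (auto intro!: exI[of _ "\<lambda>_. 1"])
next
  case (insert j J)
  have J: "card J < card I" using insert by simp
  show ?case
  proof (cases "\<forall>i\<in>I. m j i = 0")
    case True
    then show ?thesis using insert.IH[OF insert.prems(1) J, of m] by auto
  next
    case False
    then obtain k where k: "k \<in> I" "m j k \<noteq> 0" by auto
    let ?I = "I - {k}"
    have "card J < card ?I" using insert k by simp
    \<comment> \<open>Cross-multiplication with the pivot row eliminates the unknown
      \<open>k\<close>.\<close>
    from insert.IH[OF _ this, of "\<lambda>j' i. m j k * m j' i - m j' k * m j i"] insert.prems
    obtain u i0 where u: "i0 \<in> ?I" "u i0 \<noteq> 0"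
      "\<And>j'. j' \<in> J \<Longrightarrow> (\<Sum>i\<in>?I. (m j k * m j' i - m j' k * m j i) * u i) = 0" by auto
    \<comment> \<open>The value at \<open>k\<close> solves row \<open>j\<close>. The remaining
      values are scaled by the pivot, which keeps them nonzero in a domain.\<close>
    define u' where "u' = (\<lambda>i. if i = k then - (\<Sum>i\<in>?I. m j i * u i) else m j k * u i)"
    have *: "(\<Sum>i\<in>I. m j' i * u' i) = (\<Sum>i\<in>?I. (m j k * m j' i - m j' k * m j i) * u i)" for j'
    proof -
      have "(\<Sum>i\<in>I. m j' i * u' i) = m j' k * u' k + (\<Sum>i\<in>?I. m j' i * u' i)"
        using insert.prems k by (simp add: sum.remove)
      also have "(\<Sum>i\<in>?I. m j' i * u' i) = (\<Sum>i\<in>?I. m j' i * (m j k * u i))"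
        by (rule sum.cong) (auto simp: u'_def)
      also have "m j' k * u' k = - (\<Sum>i\<in>?I. m j' k * (m j i * u i))"
        by (simp add: u'_def sum_distrib_left)
      finally show ?thesis by (simp add: sum_negf[symmetric] sum.distrib[symmetric] algebra_simps)
    qed
    have "(\<Sum>i\<in>I. m j' i * u' i) = 0" if "j' \<in> insert j J" for j'
      using that u(3) by (auto simp: *)
    moreover have "u' i0 \<noteq> 0" using u k by (auto simp: u'_def)
    ultimately show ?thesis using u by blast
  qed
qed

section \<open>Polynomials over the field with two elements as coefficients\<close>

type_synonym coeffs = "(nat \<Rightarrow>\<^sub>0 nat) \<Rightarrow>\<^sub>0 bit"

lemma coeffs_char2: "c + c = 0" for c :: coeffs
proof (rule poly_mapping_eqI)
  have "b + b = 0" for b :: bit by (cases b) simp_all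
  then show "lookup (c + c) k = lookup 0 k" for k by (simp only: lookup_add lookup_zero)
qed

lemma pm_char2: "c + c = 0" for c :: "'g \<Rightarrow>\<^sub>0 coeffs"
  by (rule poly_mapping_eqI) (simp only: lookup_add coeffs_char2 lookup_zero)

lemma fps_char2: "c + c = 0" for c :: "('g \<Rightarrow>\<^sub>0 coeffs) fps"
  by (rule fps_ext) (simp only: fps_add_nth pm_char2 fps_zero_nth)

text \<open>Squaring is a Frobenius map both in the exponents and in the auxiliary variable. This
  later turns a constant term into the square of a coefficient.\<close>

lemma coef_square:
  fixes f :: "('g::real_vector \<Rightarrow>\<^sub>0 coeffs) fps"
  shows "coef (z + z) (f * f) = coef z f * coef z f"
proof (rule fps_ext)
  fix n
  have double: "x = y" if "x + x = y + y" for x y :: 'g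
    using that by (simp flip: scaleR_2)
  have "lookup (g * g) (z + z) = lookup g z * lookup g z" for g :: "'g \<Rightarrow>\<^sub>0 coeffs"
    by (rule lookup_square_char2[OF coeffs_char2 double])
  then show "coef (z + z) (f * f) $ n = (coef z f * coef z f) $ n"
    by (simp add: coef_def fps_square_nth_char2[OF pm_char2] fps_square_nth_char2[OF coeffs_char2])
qed

text \<open>
  The derivation $X_v \, \partial / \partial X_v$; unlike $\partial / \partial X_v$ it keeps exponents,
  so it just multiplies each coefficient.
\<close>

definition euler :: "nat \<Rightarrow> coeffs \<Rightarrow> coeffs" where
  "euler v = coefwise (\<lambda>k c. of_nat (lookup k v) * c)"

definition euler_coef :: "nat \<Rightarrow> coeffs fps \<Rightarrow> coeffs fps" where
  "euler_coef v f = Abs_fps (\<lambda>n. euler v (f $ n))"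

definition euler_series :: "nat \<Rightarrow> ('g::ab_group_add \<Rightarrow>\<^sub>0 coeffs) fps \<Rightarrow> ('g \<Rightarrow>\<^sub>0 coeffs) fps" where
  "euler_series v f = Abs_fps (\<lambda>n. coefwise (\<lambda>_. euler v) (f $ n))"

interpretation euler: coef_derivation "\<lambda>k c. of_nat (lookup k v) * c" for v :: nat
  by standard (simp_all only: distrib_left distrib_right lookup_add of_nat_add mult.assoc mult.left_commute)

interpretation euler_lift: coef_derivation "\<lambda>_. euler v" for v
  by standard (simp_all only: euler_def euler.coefwise_add euler.coefwise_mult)

lemma coef_euler_series: "coef z (euler_series v f) = euler_coef v (coef z f)"
  by (rule fps_ext) (simp add: coef_def euler_series_def euler_coef_def euler_lift.lookup_coefwise)

lemma euler_coef_0 [simp]: "euler_coef v 0 = 0"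
  by (rule fps_ext) (simp add: euler_coef_def)

lemma euler_series_add: "euler_series v (f + g) = euler_series v f + euler_series v g"
  by (rule fps_ext) (simp add: euler_series_def euler_lift.coefwise_add)

lemma euler_series_0 [simp]: "euler_series v 0 = 0"
  by (rule fps_ext) (simp add: euler_series_def)

lemma euler_series_sum: "euler_series v (\<Sum>i\<in>S. f i) = (\<Sum>i\<in>S. euler_series v (f i))"
  by (induction S rule: infinite_finite_induct) (simp_all add: euler_series_add)

lemma euler_series_mult: "euler_series v (f * g) = euler_series v f * g + f * euler_series v g"
proof (rule fps_ext)
  fix n
  have "coefwise (\<lambda>_. euler v) (\<Sum>i\<in>S. h i) = (\<Sum>i\<in>S. coefwise (\<lambda>_. euler v) (h i))"
    for S and h :: "nat \<Rightarrow> 'a \<Rightarrow>\<^sub>0 coeffs"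
    by (induction S rule: infinite_finite_induct) (simp_all add: euler_lift.coefwise_add)
  then show "euler_series v (f * g) $ n = (euler_series v f * g + f * euler_series v g) $ n"
    by (simp add: euler_series_def fps_mult_nth euler_lift.coefwise_mult sum.distrib)
qed

text \<open>The Leibniz rule gives the same product twice, so in characteristic 2 a square is a
  constant for every one of these derivations.\<close>

lemma euler_series_square: "euler_series v (f * f) = 0"
  using fps_char2[of "euler_series v f * f"] by (simp only: euler_series_mult mult.commute[of f "euler_series v f"])

lemma euler_one [simp]: "euler v 1 = 0"
proof -
  have "euler v 1 = euler v 1 + euler v 1"
    using euler.coefwise_mult[of v 1 1] unfolding euler_def by (simp only: mult_1_left mult_1_right)
  then show ?thesis by (simp only: add_cancel_right_right)
qed

lemma euler_series_lmonom: "euler_series v (lmonom z) = 0"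
  by (rule fps_ext) (simp add: euler_series_def lmonom_def euler_lift.coefwise_single)

lemma euler_series_1 [simp]: "euler_series v 1 = 0"
  using euler_series_lmonom[of v 0] by simp

lemma euler_series_scalar: "euler_series v (scalar c) = scalar (euler_coef v c)"
  by (rule fps_ext) (simp add: euler_series_def scalar_def euler_coef_def euler_lift.coefwise_single)

lemma euler_series_prod_eq_0:
  "(\<And>i. i \<in> S \<Longrightarrow> euler_series v (f i) = 0) \<Longrightarrow> euler_series v (\<Prod>i\<in>S. f i) = 0"
  by (induction S rule: infinite_finite_induct) (simp_all add: euler_series_mult)

text \<open>The factor \<open>fps_X\<close> makes the indeterminates infinitesimal.\<close>

definition indet :: "nat \<Rightarrow> coeffs fps" where
  "indet v = fps_X * fps_const (Poly_Mapping.single (Poly_Mapping.single v 1) 1)"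

lemma indet_nonzero: "indet v \<noteq> 0"
proof -
  have "Poly_Mapping.single (Poly_Mapping.single v 1) 1 \<noteq> (0 :: coeffs)"
    by (metis lookup_single_eq lookup_zero zero_neq_one)
  then show ?thesis by (simp add: indet_def)
qed

lemma euler_coef_indet: "euler_coef v (indet w) = (if v = w then indet w else 0)"
proof (rule fps_ext)
  fix n
  have *: "euler u (Poly_Mapping.single (Poly_Mapping.single w (Suc 0)) 1) =
      (if u = w then Poly_Mapping.single (Poly_Mapping.single w (Suc 0)) 1 else 0)" for u
    unfolding euler_def euler.coefwise_single by (auto simp: lookup_single when_def)
  have "euler v 0 = 0" unfolding euler_def by (rule euler.coefwise_zero)
  then show "euler_coef v (indet w) $ n = (if v = w then indet w else 0) $ n"
    unfolding euler_coef_def indet_def by (auto simp: *)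
qed

section \<open>Generic linear forms and the Lefschetz property\<close>

text \<open>Coordinates dual to the generators \<open>w j\<close>, which need to separate points
  only on \<open>L\<close>. The cone lattices of the simplex and of a face are both instances, so
  that their boxes can be compared.\<close>

locale lattice_coordinates =
  fixes L :: "'g::real_vector set" and J :: "nat set"
    and \<kappa> :: "nat \<Rightarrow> 'g \<Rightarrow> real" and w :: "nat \<Rightarrow> 'g"
  assumes finite_J: "finite J"
    and linear_\<kappa>: "\<And>j. linear (\<kappa> j)"
    and zero_in_L: "0 \<in> L"
    and add_in_L: "\<And>p q. p \<in> L \<Longrightarrow> q \<in> L \<Longrightarrow> p + q \<in> L"
    and minus_in_L: "\<And>p. p \<in> L \<Longrightarrow> - p \<in> L"
    and w_in_L: "\<And>j. j \<in> J \<Longrightarrow> w j \<in> L"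
    and \<kappa>_w: "\<And>i j. i \<in> J \<Longrightarrow> j \<in> J \<Longrightarrow> \<kappa> i (w j) = of_bool (i = j)"
    and \<kappa>_eq_0: "\<And>p. p \<in> L \<Longrightarrow> (\<And>j. j \<in> J \<Longrightarrow> \<kappa> j p = 0) \<Longrightarrow> p = 0"
    and sum_\<kappa>_int: "\<And>p. p \<in> L \<Longrightarrow> (\<Sum>j\<in>J. \<kappa> j p) \<in> \<int>"
begin

section \<open>Height, box and interior points\<close>

definition ht :: "'g \<Rightarrow> real" where
  "ht p = (\<Sum>j\<in>J. \<kappa> j p)"

definition box :: "'g set" where
  "box = {p \<in> L. \<forall>j\<in>J. 0 \<le> \<kappa> j p \<and> \<kappa> j p < 1}"

definition level :: "nat \<Rightarrow> 'g set" where
  "level n = {p \<in> box. ht p = real n}"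

definition interior_points :: "'g set" where
  "interior_points = {p \<in> L. \<forall>j\<in>J. 0 < \<kappa> j p}"

definition \<sigma> :: 'g where
  "\<sigma> = (\<Sum>j\<in>J. w j)"

lemmas \<kappa>_simps =
  linear_0[OF linear_\<kappa>] linear_add[OF linear_\<kappa>] linear_diff[OF linear_\<kappa>] linear_neg[OF linear_\<kappa>]
  linear_sum[OF linear_\<kappa>] linear_scale[OF linear_\<kappa>]

lemma diff_in_L: "p \<in> L \<Longrightarrow> q \<in> L \<Longrightarrow> p - q \<in> L"
  using add_in_L[of p "- q"] minus_in_L[of q] by simp

lemma sum_in_L: "(\<And>i. i \<in> S \<Longrightarrow> f i \<in> L) \<Longrightarrow> (\<Sum>i\<in>S. f i) \<in> L"
  by (induction S rule: infinite_finite_induct) (auto intro: zero_in_L add_in_L)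

lemma of_nat_scale_in_L: "p \<in> L \<Longrightarrow> real n *\<^sub>R p \<in> L"
  by (induction n) (auto intro: zero_in_L add_in_L simp: scaleR_add_left)

lemma of_int_scale_in_L: "p \<in> L \<Longrightarrow> of_int k *\<^sub>R p \<in> L"
  by (cases k rule: int_cases2) (auto intro: of_nat_scale_in_L minus_in_L)

lemma ht_simps: "ht 0 = 0" "ht (p + q) = ht p + ht q" "ht (p - q) = ht p - ht q"
  by (simp_all add: ht_def \<kappa>_simps sum.distrib sum_subtractf)

lemma ht_w: "j \<in> J \<Longrightarrow> ht (w j) = 1"
  using finite_J by (simp add: ht_def \<kappa>_w)

lemma \<kappa>_\<sigma>: "j \<in> J \<Longrightarrow> \<kappa> j \<sigma> = 1"
  using finite_J by (simp add: \<sigma>_def \<kappa>_simps \<kappa>_w)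

lemma ht_\<sigma>: "ht \<sigma> = card J"
  by (simp add: ht_def \<kappa>_\<sigma>)

lemma \<sigma>_in_L: "\<sigma> \<in> L"
  by (auto simp: \<sigma>_def intro: sum_in_L w_in_L)

lemma interior_add:
  "p \<in> interior_points \<Longrightarrow> q \<in> L \<Longrightarrow> (\<And>j. j \<in> J \<Longrightarrow> 0 \<le> \<kappa> j q) \<Longrightarrow> p + q \<in> interior_points"
  by (auto simp: interior_points_def \<kappa>_simps intro: add_in_L add_pos_nonneg)

lemma levelD: "p \<in> level n \<Longrightarrow> p \<in> L" "p \<in> level n \<Longrightarrow> ht p = real n"
  "p \<in> level n \<Longrightarrow> j \<in> J \<Longrightarrow> 0 \<le> \<kappa> j p" "p \<in> level n \<Longrightarrow> j \<in> J \<Longrightarrow> \<kappa> j p < 1"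
  by (auto simp: level_def box_def)

lemma level_0: "level 0 = {0}"
proof (intro equalityI subsetI)
  fix p assume p: "p \<in> level 0"
  then have "(\<Sum>j\<in>J. \<kappa> j p) = 0" by (auto dest: levelD simp: ht_def)
  then have "\<forall>j\<in>J. \<kappa> j p = 0" using finite_J p by (subst (asm) sum_nonneg_eq_0_iff) (auto dest: levelD)
  then show "p \<in> {0}" using \<kappa>_eq_0[of p] p by (auto dest: levelD)
qed (auto simp: level_def box_def zero_in_L \<kappa>_simps ht_simps)

lemma level_empty:
  assumes "n \<ge> card J" "n > 0"
  shows "level n = {}"
proof -
  have False if p: "p \<in> level n" for p
  proof -
    have "sum (\<lambda>j. \<kappa> j p) J \<noteq> 0" using levelD(2)[OF p] assms(2) by (simp add: ht_def)
    then have "J \<noteq> {}" by (metis sum.empty)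
    then have "ht p < (\<Sum>j\<in>J. 1)"
      unfolding ht_def using finite_J p by (intro sum_strict_mono) (auto dest: levelD)
    then show False using levelD(2)[OF p] assms by simp
  qed
  then show ?thesis by auto
qed

end

text \<open>\<open>generated\<close> is what the integer decomposition property says about box
  points: the summands are again in the box, at height 1.\<close>

locale full_support_coordinates = lattice_coordinates +
  assumes finite_box: "finite box"
    and full_support: "\<And>p j. p \<in> box \<Longrightarrow> p \<noteq> 0 \<Longrightarrow> j \<in> J \<Longrightarrow> \<kappa> j p \<noteq> 0"
    and generated: "\<And>p n. p \<in> level n \<Longrightarrow> n > 0 \<Longrightarrow> \<exists>f. (\<forall>i<n. f i \<in> level 1) \<and> p = (\<Sum>i<n. f i)"
begin

lemma finite_level: "finite (level n)"
  using finite_box by (simp add: level_def)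

lemma level_interior: "p \<in> level n \<Longrightarrow> n > 0 \<Longrightarrow> p \<in> interior_points"
proof -
  assume p: "p \<in> level n" "n > 0"
  then have "p \<noteq> 0" by (auto simp: level_def ht_simps)
  then show ?thesis
    using p full_support[of p] by (fastforce simp: level_def box_def interior_points_def)
qed

text \<open>Full support makes every coordinate of \<open>p\<close> strictly positive, hence those
  of \<open>\<sigma> - p\<close> are strictly below 1.\<close>

lemma \<sigma>_diff_level:
  assumes "p \<in> level n" "0 < n" "n \<le> card J"
  shows "\<sigma> - p \<in> level (card J - n)"
  using level_interior[OF assms(1,2)] assms
  by (auto simp: level_def box_def interior_points_def \<kappa>_simps ht_simps \<kappa>_\<sigma> ht_\<sigma> of_nat_diff
      intro!: diff_in_L \<sigma>_in_L)

lemma card_level_symmetric: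
  assumes "0 < n" "n < card J"
  shows "card (level n) = card (level (card J - n))"
proof (rule bij_betw_same_card, rule bij_betwI)
  show "(\<lambda>p. \<sigma> - p) \<in> level n \<rightarrow> level (card J - n)"
    using assms by (auto intro: \<sigma>_diff_level)
  show "(\<lambda>p. \<sigma> - p) \<in> level (card J - n) \<rightarrow> level n"
    using assms \<sigma>_diff_level[of _ "card J - n"] by auto
qed auto

section \<open>Generic linear forms and their inverses\<close>

definition var :: "nat \<Rightarrow> 'a \<Rightarrow> nat" where
  "var s a = prod_encode (s, (SOME f. inj_on f (level 1)) a)"

text \<open>Each pair of an index \<open>s\<close> and a box point of height 1 has its own
  indeterminate, so the forms can be differentiated independently.\<close>

definition generic_part :: "nat \<Rightarrow> ('a \<Rightarrow>\<^sub>0 coeffs) fps" where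
  "generic_part s = (\<Sum>a\<in>level 1. scalar (indet (var s a)) * lmonom a)"

text \<open>For \<open>s\<close> in \<open>J\<close> this is a perturbed monomial, a theta of the
  overview; for other \<open>s\<close> it is one of the additional forms. A common index set lets
  one lemma differentiate all of them.\<close>

definition form :: "nat \<Rightarrow> ('a \<Rightarrow>\<^sub>0 coeffs) fps" where
  "form s = (if s \<in> J then lmonom (w s) else 0) + generic_part s"

definition form_inv :: "nat \<Rightarrow> ('a \<Rightarrow>\<^sub>0 coeffs) fps" where
  "form_inv j = fps_right_inverse (form j) (Poly_Mapping.single (- w j) 1)"

text \<open>The functional phi of the overview sends \<open>f\<close> to
  \<open>coef 0 (f * \<Omega>)\<close>.\<close>

definition \<Omega> :: "('a \<Rightarrow>\<^sub>0 coeffs) fps" where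
  "\<Omega> = (\<Prod>j\<in>J. form_inv j)"

lemma var_eq_iff: "a \<in> level 1 \<Longrightarrow> b \<in> level 1 \<Longrightarrow> var s a = var t b \<longleftrightarrow> s = t \<and> a = b"
proof -
  assume ab: "a \<in> level 1" "b \<in> level 1"
  have "\<exists>f :: 'a \<Rightarrow> nat. inj_on f (level 1)"
    using finite_imp_inj_to_nat_seg[OF finite_level] by blast
  then have "inj_on (SOME f :: 'a \<Rightarrow> nat. inj_on f (level 1)) (level 1)" by (rule someI_ex)
  then show ?thesis using ab by (auto simp: var_def inj_on_def)
qed

lemma generic_part_nth_0: "fps_nth (generic_part s) 0 = 0"
  by (simp add: generic_part_def fps_sum_nth scalar_def indet_def)

lemma form_nth_0: "j \<in> J \<Longrightarrow> fps_nth (form j) 0 = Poly_Mapping.single (w j) 1"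
  by (simp add: form_def generic_part_nth_0 lmonom_def)

lemma form_inv_nth_0: "fps_nth (form_inv j) 0 = Poly_Mapping.single (- w j) 1"
  by (simp add: form_inv_def)

lemma form_mult_inv: "j \<in> J \<Longrightarrow> form j * form_inv j = 1"
  unfolding form_inv_def by (rule fps_right_inverse) (simp add: form_nth_0 mult_single single_one)

lemma prod_form_mult_\<Omega>: "(\<Prod>j\<in>J. form j) * \<Omega> = 1"
  by (simp add: \<Omega>_def form_mult_inv flip: prod.distrib)

lemma generic_part_supported: "j \<in> J \<Longrightarrow> supported {z. 0 \<le> \<kappa> j z} (generic_part s)"
  unfolding generic_part_def
  by (intro supported_sum supported_scalar_mult supported_lmonom) (auto dest: levelD)

text \<open>The inverse \<open>g\<close> of \<open>form i\<close> satisfies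
  \<open>g = lmonom (- w i) * (1 - generic_part i * g)\<close>. Here \<open>- w i\<close> has
  \<open>j\<close>-coordinate 0 and the exponents of \<open>generic_part i\<close> have nonnegative
  ones. As \<open>generic_part i\<close> starts in order 1, induction on the order applies.\<close>

lemma form_inv_supported:
  assumes "i \<in> J" "j \<in> J" "i \<noteq> j"
  shows "supported {z. 0 \<le> \<kappa> j z} (form_inv i)"
  unfolding supported_def
proof
  let ?S = "{z. 0 \<le> \<kappa> j z}"
  have mult: "Poly_Mapping.keys (f * g) \<subseteq> ?S"
    if "Poly_Mapping.keys f \<subseteq> ?S" "Poly_Mapping.keys g \<subseteq> ?S" for f g :: "'a \<Rightarrow>\<^sub>0 coeffs"
    using keys_mult[of f g] that by (fastforce simp: \<kappa>_simps)
  fix n show "Poly_Mapping.keys (fps_nth (form_inv i) n) \<subseteq> ?S"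
  proof (induction n rule: less_induct)
    case (less n)
    have "lmonom (w i) * form_inv i = 1 - generic_part i * form_inv i"
      using form_mult_inv[OF assms(1)] assms by (simp add: form_def algebra_simps)
    then have "lmonom (- w i) * (lmonom (w i) * form_inv i) = lmonom (- w i) * (1 - generic_part i * form_inv i)"
      by simp
    then have "form_inv i = lmonom (- w i) * (1 - generic_part i * form_inv i)"
      by (simp add: lmonom_mult mult.assoc[symmetric])
    then have *: "fps_nth (form_inv i) n =
        Poly_Mapping.single (- w i) 1 * (fps_nth 1 n - fps_nth (generic_part i * form_inv i) n)"
      by (metis lmonom_def fps_mult_left_const_nth fps_sub_nth)
    have "Poly_Mapping.keys (fps_nth (generic_part i * form_inv i) n) \<subseteq> ?S"
      unfolding fps_mult_nth
    proof (rule keys_sum_subset)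
      fix k assume "k \<in> {0..n}"
      then show "Poly_Mapping.keys (fps_nth (generic_part i) k * fps_nth (form_inv i) (n - k)) \<subseteq> ?S"
        using less.IH[of "n - k"] generic_part_supported[OF assms(2), of i]
        by (cases "k = 0") (simp_all add: generic_part_nth_0 supported_def mult)
    qed
    moreover have "Poly_Mapping.keys (fps_nth (1 :: ('a \<Rightarrow>\<^sub>0 coeffs) fps) n) \<subseteq> ?S"
      by (auto simp: fps_one_nth \<kappa>_simps simp flip: single_one)
    ultimately have "Poly_Mapping.keys (fps_nth 1 n - fps_nth (generic_part i * form_inv i) n) \<subseteq> ?S"
      using keys_diff by fastforce
    moreover have "Poly_Mapping.keys (Poly_Mapping.single (- w i) (1::coeffs)) \<subseteq> ?S"
      using assms by (auto simp: \<kappa>_simps \<kappa>_w)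
    ultimately show ?case unfolding * by (intro mult)
  qed
qed

text \<open>Multiplication by \<open>form j\<close> cancels the only factor of
  \<open>\<Omega>\<close> that can lower the \<open>j\<close>-coordinate. All exponents then have
  positive \<open>j\<close>-coordinate, so 0 is not among them.\<close>

lemma coef_form_mult_eq_0:
  assumes "j \<in> J" "supported {z. 0 < \<kappa> j z} f"
  shows "coef 0 (form j * f * \<Omega>) = 0"
proof -
  have "supported {z. 0 \<le> \<kappa> j z} (\<Prod>i\<in>S. form_inv i)" if "S \<subseteq> J - {j}" for S
    using finite_subset[OF that] finite_J that
  proof (induction S rule: infinite_finite_induct)
    case empty
    then show ?case using supported_lmonom[of 0 "{z. 0 \<le> \<kappa> j z}"] by (simp add: \<kappa>_simps)
  next
    case (insert i S)
    then have "supported {z. 0 \<le> \<kappa> j z} (form_inv i * (\<Prod>i\<in>S. form_inv i))"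
      using assms(1) by (intro supported_mult[OF form_inv_supported]) (auto simp: \<kappa>_simps)
    then show ?case using insert.hyps by simp
  qed auto
  then have "supported {z. 0 < \<kappa> j z} (f * (\<Prod>i\<in>J - {j}. form_inv i))"
    by (intro supported_mult[OF assms(2)]) (auto simp: \<kappa>_simps)
  moreover have "form j * f * \<Omega> = f * (\<Prod>i\<in>J - {j}. form_inv i)"
  proof -
    have "form j * f * \<Omega> = (form j * form_inv j) * (f * (\<Prod>i\<in>J - {j}. form_inv i))"
      unfolding \<Omega>_def prod.remove[OF finite_J assms(1)] by (simp only: ac_simps)
    then show ?thesis by (simp add: form_mult_inv[OF assms(1)])
  qed
  ultimately show ?thesis by (simp add: coef_eq_0_if_supported \<kappa>_simps)
qed

text \<open>In order 0 the forms are the monomials of the \<open>w j\<close>, so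
  \<open>\<Omega>\<close> reduces to the monomial with exponent \<open>- \<sigma>\<close>.\<close>

lemma coef_lmonom_\<Omega>_nth_0: "fps_nth (coef 0 (lmonom z * \<Omega>)) 0 = of_bool (z = \<sigma>)"
proof -
  have "fps_nth (\<Prod>j\<in>S. form_inv j) 0 = Poly_Mapping.single (- (\<Sum>j\<in>S. w j)) 1" for S
    by (induction S rule: infinite_finite_induct)
       (simp_all add: form_inv_nth_0 mult_single single_one add.commute)
  then have "fps_nth \<Omega> 0 = Poly_Mapping.single (- \<sigma>) 1" by (simp add: \<Omega>_def \<sigma>_def)
  then show ?thesis by (auto simp: coef_def lmonom_def lookup_single_mult lookup_single when_def)
qed

section \<open>Constant terms at interior points\<close>

lemma indet_mult_nth_Suc:
  "fps_nth (indet v * c) (Suc n) = Poly_Mapping.single (Poly_Mapping.single v 1) 1 * fps_nth c n"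
  by (simp_all add: indet_def mult.assoc)

text \<open>Outside the box some coordinate is at least 1. If it is larger than 1, then
  \<open>w j\<close> can be subtracted within the interior; the value 1 is excluded by full support
  and the bound on the height.\<close>

lemma interior_reduce:
  assumes z: "z \<in> interior_points" "ht z = real e" "e < card J" "z \<notin> level e"
  shows "\<exists>j\<in>J. z - w j \<in> interior_points"
proof -
  have zL: "z \<in> L" and pos: "\<And>j. j \<in> J \<Longrightarrow> 0 < \<kappa> j z" using z by (auto simp: interior_points_def)
  obtain j where j: "j \<in> J" "1 \<le> \<kappa> j z"
    using z pos by (force simp: level_def box_def interior_points_def)
  have "\<kappa> j z \<noteq> 1"
  proof
    assume one: "\<kappa> j z = 1"
    \<comment> \<open>The fractional parts of the coordinates give a box point whose
      \<open>j\<close>-coordinate is 0, so it is 0 by full support. Then all coordinates of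
      \<open>z\<close> are positive integers, and its height is at least
      \<open>card J\<close>.\<close>
    define p where "p = z - (\<Sum>i\<in>J. of_int \<lfloor>\<kappa> i z\<rfloor> *\<^sub>R w i)"
    have pL: "p \<in> L"
      unfolding p_def by (intro diff_in_L zL sum_in_L of_int_scale_in_L w_in_L)
    have kp: "\<kappa> i p = frac (\<kappa> i z)" if "i \<in> J" for i
      using that finite_J by (simp add: p_def \<kappa>_simps \<kappa>_w frac_def)
    have "p = 0"
    proof (rule ccontr)
      assume "p \<noteq> 0"
      moreover have "p \<in> box" using pL by (auto simp: box_def kp frac_lt_1)
      ultimately show False using full_support[of p j] j(1) one by (simp add: kp)
    qed
    then have "1 \<le> \<kappa> i z" if "i \<in> J" for i
      using kp[OF that] pos[OF that] by (auto simp: \<kappa>_simps frac_eq_0_iff elim!: Ints_cases)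
    then have "(\<Sum>i\<in>J. 1) \<le> ht z" unfolding ht_def by (intro sum_mono) auto
    then show False using z by simp
  qed
  then have "z - w j \<in> interior_points"
    using j pos zL by (auto simp: interior_points_def \<kappa>_simps \<kappa>_w intro: diff_in_L w_in_L)
  then show ?thesis using j by blast
qed

text \<open>Modulo the forms, a monomial outside the box equals a combination of interior monomials
  of the same height with infinitesimal coefficients. Repeating this pushes the discrepancy to
  arbitrarily high order in the auxiliary variable.\<close>

lemma propagate_to_interior:
  assumes f: "\<And>j. j \<in> J \<Longrightarrow> supported {z. 0 \<le> \<kappa> j z} f"
    and e: "e < card J"
    and lev: "\<And>y. y \<in> level e \<Longrightarrow> coef 0 (f * lmonom y * \<Omega>) = 0"
    and z: "z \<in> interior_points" "ht z = real e"
  shows "coef 0 (f * lmonom z * \<Omega>) = 0"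
proof (rule fps_ext)
  fix n
  let ?\<psi> = "\<lambda>z. coef 0 (f * lmonom z * \<Omega>)"
  \<comment> \<open>With \<open>y = z - w j\<close>, expand \<open>form j * lmonom y\<close>: its
    leading part is \<open>lmonom z\<close>, and the whole product contributes 0 by
    \<open>coef_form_mult_eq_0\<close>.\<close>
  have step: "\<exists>j y. (\<forall>a\<in>level 1. y + a \<in> interior_points \<and> ht (y + a) = real e) \<and>
      ?\<psi> z = - (\<Sum>a\<in>level 1. indet (var j a) * ?\<psi> (y + a))"
    if z: "z \<in> interior_points" "ht z = real e" "z \<notin> level e" for z
  proof -
    obtain j where j: "j \<in> J" "z - w j \<in> interior_points"
      using interior_reduce[OF z(1,2) e z(3)] by blast
    let ?y = "z - w j"
    have "y \<in> interior_points \<Longrightarrow> a \<in> level 1 \<Longrightarrow> y + a \<in> interior_points" for y a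
      by (rule interior_add) (auto dest: levelD)
    then have int: "\<forall>a\<in>level 1. ?y + a \<in> interior_points \<and> ht (?y + a) = real e"
      using z j by (auto simp: ht_simps ht_w dest: levelD)
    have "supported {z. 0 < \<kappa> j z} (lmonom ?y)"
      using j by (intro supported_lmonom) (auto simp: interior_points_def)
    then have "supported {z. 0 < \<kappa> j z} (f * lmonom ?y)"
      by (rule supported_mult[OF f[OF j(1)]]) (auto simp: \<kappa>_simps)
    then have "coef 0 (form j * (f * lmonom ?y) * \<Omega>) = 0" by (rule coef_form_mult_eq_0[OF j(1)])
    moreover have "form j * (f * lmonom ?y) * \<Omega>
        = f * lmonom z * \<Omega> + (\<Sum>a\<in>level 1. scalar (indet (var j a)) * (f * lmonom (?y + a) * \<Omega>))"
    proof -
      have "form j * (f * lmonom ?y) * \<Omega>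
          = f * (lmonom (w j) * lmonom ?y) * \<Omega> + generic_part j * (f * lmonom ?y * \<Omega>)"
        using j by (simp add: form_def algebra_simps)
      also have "generic_part j * (f * lmonom ?y * \<Omega>)
          = (\<Sum>a\<in>level 1. scalar (indet (var j a)) * (f * (lmonom ?y * lmonom a) * \<Omega>))"
        by (simp add: generic_part_def sum_distrib_right sum_distrib_left ac_simps)
      finally show ?thesis by (simp add: lmonom_mult)
    qed
    ultimately have "?\<psi> z + (\<Sum>a\<in>level 1. indet (var j a) * ?\<psi> (?y + a)) = 0"
      by (simp add: coef_add coef_sum coef_scalar_mult)
    then show ?thesis using int by (auto simp: eq_neg_iff_add_eq_0 intro!: exI[of _ j] exI[of _ ?y])
  qed
  show "fps_nth (?\<psi> z) n = fps_nth 0 n"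
    using z
  proof (induction n arbitrary: z)
    case (0 z)
    show ?case
    proof (cases "z \<in> level e")
      case False
      then obtain j y where "?\<psi> z = - (\<Sum>a\<in>level 1. indet (var j a) * ?\<psi> (y + a))"
        using step[of z] 0 by blast
      then show ?thesis by (simp add: fps_sum_nth indet_def)
    qed (simp add: lev)
  next
    case (Suc n z)
    show ?case
    proof (cases "z \<in> level e")
      case False
      then obtain j y where "\<forall>a\<in>level 1. y + a \<in> interior_points \<and> ht (y + a) = real e"
        and "?\<psi> z = - (\<Sum>a\<in>level 1. indet (var j a) * ?\<psi> (y + a))"
        using step[of z] Suc.prems by blast
      then show ?thesis using Suc.IH by (simp add: fps_sum_nth indet_mult_nth_Suc)
    qed (simp add: lev)
  qed
qed

text \<open>Expanding the product adds one height-1 box point to \<open>z\<close> per factor, which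
  ends at interior points of height \<open>e\<close>.\<close>

lemma generic_product_eq_0:
  assumes "finite F"
    and lev: "\<And>z. z \<in> interior_points \<Longrightarrow> ht z = real e \<Longrightarrow> coef 0 (f * lmonom z * \<Omega>) = 0"
    and "z \<in> interior_points" "ht z + real (card F) = real e"
  shows "coef 0 (f * (lmonom z * (\<Prod>s\<in>F. generic_part s)) * \<Omega>) = 0"
  using assms(1,3,4)
proof (induction F arbitrary: z rule: finite_induct)
  case (insert s F)
  have "f * (lmonom z * (\<Prod>s\<in>insert s F. generic_part s)) * \<Omega>
      = (\<Sum>a\<in>level 1. scalar (indet (var s a)) *
          (f * ((lmonom z * lmonom a) * (\<Prod>s\<in>F. generic_part s)) * \<Omega>))"
    using insert.hyps
    by (simp add: generic_part_def sum_distrib_right sum_distrib_left ac_simps)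
  moreover have "coef 0 (f * (lmonom (z + a) * (\<Prod>s\<in>F. generic_part s)) * \<Omega>) = 0"
    if "a \<in> level 1" for a
    using that insert by (intro insert.IH interior_add) (auto dest: levelD simp: ht_simps)
  ultimately show ?case by (simp add: coef_sum coef_scalar_mult lmonom_mult)
qed (simp add: lev)

section \<open>Differentiation with respect to the generic coefficients\<close>

lemma euler_series_form:
  assumes "c \<in> level 1"
  shows "euler_series (var s c) (form t) =
    (if s = t then scalar (indet (var s c)) * lmonom c else 0)"
proof -
  have "euler_series (var s c) (form t) = (\<Sum>a\<in>level 1.
      if a = c then (if s = t then scalar (indet (var s c)) * lmonom c else 0) else 0)"
    by (auto simp: form_def generic_part_def euler_series_add euler_series_sum euler_series_mult
        euler_series_scalar euler_series_lmonom euler_coef_indet var_eq_iff assms scalar_0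
        simp del: One_nat_def intro!: sum.cong)
  then show ?thesis using assms finite_level by (simp del: One_nat_def)
qed

text \<open>The derivation for the coefficient of \<open>c s\<close> in \<open>form s\<close>
  replaces this factor by a single term. It kills \<open>K\<close>, the other forms and the terms
  already substituted, so the factors can be replaced one at a time.\<close>

lemma differentiate_forms:
  assumes S: "finite S" "\<And>s. s \<in> S \<Longrightarrow> c s \<in> level 1"
    and K: "\<And>v. euler_series v K = 0"
    and zero: "coef z ((\<Prod>s\<in>S. form s) * K) = 0"
    and F: "F \<subseteq> S"
  shows "coef z ((\<Prod>s\<in>F. scalar (indet (var s (c s))) * lmonom (c s)) *
    (\<Prod>s\<in>S - F. form s) * K) = 0"
  using finite_subset[OF F S(1)] F
proof (induction F rule: finite_induct)
  case empty
  then show ?case by (simp add: zero)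
next
  case (insert s F)
  let ?m = "\<lambda>s. scalar (indet (var s (c s))) * lmonom (c s)"
  let ?v = "var s (c s)" and ?M = "\<Prod>t\<in>F. ?m t" and ?G = "\<Prod>t\<in>S - insert s F. form t"
  have s: "s \<in> S" "S - F = insert s (S - insert s F)" using insert.prems insert.hyps by auto
  have "euler_series ?v ?M = 0"
  proof (rule euler_series_prod_eq_0)
    fix t assume "t \<in> F"
    then have "var s (c s) \<noteq> var t (c t)" using insert.prems insert.hyps S(2) by (subst var_eq_iff) auto
    then show "euler_series ?v (?m t) = 0"
      by (simp add: euler_series_mult euler_series_scalar euler_series_lmonom euler_coef_indet scalar_0)
  qed
  moreover have "euler_series ?v ?G = 0"
    by (rule euler_series_prod_eq_0) (use S(2) s in \<open>auto simp: euler_series_form\<close>)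
  \<comment> \<open>Everything except \<open>form s\<close> is constant for this derivation, so the
    product rule leaves one summand.\<close>
  ultimately have "euler_series ?v (?M * ?G * K) = 0"
    by (simp only: euler_series_mult K mult_zero_left mult_zero_right add_0)
  then have "euler_series ?v (?M * ?G * K * form s) = ?M * ?G * K * ?m s"
    using euler_series_form[OF S(2)[OF s(1)], of s s]
    by (simp only: euler_series_mult mult_zero_left add_0 if_True simp_thms)
  moreover have "coef z (?M * ?G * K * form s) = 0"
  proof -
    have "coef z (?M * (\<Prod>s\<in>S - F. form s) * K) = 0" using insert.IH insert.prems by blast
    also have "?M * (\<Prod>s\<in>S - F. form s) * K = ?M * ?G * K * form s"
    proof -
      have "(\<Prod>s\<in>S - F. form s) = form s * ?G"
        unfolding s(2) using S(1) by (intro prod.insert) auto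
      then show ?thesis by (simp only: ac_simps)
    qed
    finally show ?thesis .
  qed
  ultimately have "coef z (?M * ?G * K * ?m s) = 0"
    using coef_euler_series[of z ?v "?M * ?G * K * form s"] by (simp only: euler_coef_0)
  also have "?M * ?G * K * ?m s = (\<Prod>t\<in>insert s F. ?m t) * ?G * K"
  proof -
    have "(\<Prod>t\<in>insert s F. ?m t) = ?m s * ?M" by (rule prod.insert) (fact insert.hyps)+
    then show ?thesis by (simp only: ac_simps)
  qed
  finally show ?case .
qed

text \<open>Substituting each of the \<open>n\<close> summands of \<open>y\<close> for two forms
  produces the exponent \<open>y + y\<close>, where the coefficient of a square is a square.\<close>

lemma coef_level_eq_0:
  assumes S: "finite S" "card S = 2 * n" and n: "n > 0"
    and zero: "coef 0 ((\<Prod>s\<in>S. form s) * (R * R)) = 0"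
    and y: "y \<in> level n"
  shows "coef 0 (lmonom y * R) = 0"
proof -
  obtain f where f: "\<And>i. i < n \<Longrightarrow> f i \<in> level 1" "y = (\<Sum>i<n. f i)"
    using generated[OF y n] by blast
  obtain h where h: "bij_betw h S {..<2 * n}"
    using S ex_bij_betw_finite_nat[OF S(1)] by (auto simp: atLeast0LessThan)
  \<comment> \<open>Halving the number of an index assigns every \<open>f i\<close> to exactly two
    forms.\<close>
  define c where "c = (\<lambda>s. f (h s div 2))"
  have hS: "h s < 2 * n" if "s \<in> S" for s using h that by (auto simp: bij_betw_def)
  have c: "c s \<in> level 1" if "s \<in> S" for s
    unfolding c_def by (rule f(1)) (use hS[OF that] in auto)
  have "(\<Sum>t<2 * m. f (t div 2)) = (\<Sum>i<m. f i) + (\<Sum>i<m. f i)" for m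
    by (induction m) (simp_all add: algebra_simps)
  then have sum_c: "(\<Sum>s\<in>S. c s) = y + y"
    unfolding c_def using sum.reindex_bij_betw[OF h, of "\<lambda>t. f (t div 2)"] f(2) by simp
  let ?e = "\<Prod>s\<in>S. indet (var s (c s))"
  have "coef 0 ((\<Prod>s\<in>S. scalar (indet (var s (c s))) * lmonom (c s)) *
      (\<Prod>s\<in>S - S. form s) * (R * R)) = 0"
    by (rule differentiate_forms[OF S(1) c euler_series_square zero]) auto
  also have "(\<Prod>s\<in>S. scalar (indet (var s (c s))) * lmonom (c s)) = scalar ?e * lmonom (y + y)"
    by (simp add: prod.distrib scalar_prod lmonom_prod sum_c)
  finally have "?e * coef (- y + - y) (R * R) = 0"
    by (simp add: mult.assoc coef_scalar_mult coef_lmonom_mult)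
  moreover have "?e \<noteq> 0" using S(1) by (simp add: indet_nonzero)
  ultimately have "coef (- y) R = 0" by (simp only: mult_eq_0_iff coef_square) simp
  then show ?thesis by (simp add: coef_lmonom_mult)
qed

text \<open>By \<open>coef_lmonom_\<Omega>_nth_0\<close> the matrix of the pairing is the identity
  in order 0, so the coefficients of \<open>u\<close> vanish order by order.\<close>

lemma nondegenerate:
  assumes "\<And>x. x \<in> level i \<Longrightarrow>
      coef 0 (lmonom (\<sigma> - x) * ((\<Sum>y\<in>level i. scalar (u y) * lmonom y) * \<Omega>)) = 0"
    and "x \<in> level i"
  shows "u x = 0"
proof (rule fps_ext)
  fix n
  show "fps_nth (u x) n = fps_nth 0 n"
    using assms(2)
  proof (induction n arbitrary: x rule: less_induct)
    case (less n)
    let ?\<phi> = "\<lambda>y. coef 0 (lmonom (\<sigma> - x + y) * \<Omega>)"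
    have "lmonom (\<sigma> - x) * ((\<Sum>y\<in>level i. scalar (u y) * lmonom y) * \<Omega>)
        = (\<Sum>y\<in>level i. scalar (u y) * ((lmonom (\<sigma> - x) * lmonom y) * \<Omega>))"
      by (simp add: sum_distrib_left sum_distrib_right ac_simps)
    then have "(\<Sum>y\<in>level i. u y * ?\<phi> y) = 0"
      using assms(1)[OF less.prems] by (simp add: coef_sum coef_scalar_mult lmonom_mult)
    then have "fps_nth (\<Sum>y\<in>level i. u y * ?\<phi> y) n = 0" by (simp only: fps_zero_nth)
    then have "0 = (\<Sum>y\<in>level i. fps_nth (u y * ?\<phi> y) n)" by (simp only: fps_sum_nth)
    also have "\<dots> = (\<Sum>y\<in>level i. if y = x then fps_nth (u y) n else 0)"
    proof (rule sum.cong[OF refl])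
      fix y assume y: "y \<in> level i"
      \<comment> \<open>The lower coefficients of \<open>u y\<close> vanish by induction, so only
        order 0 of the pairing contributes.\<close>
      have "fps_nth (u y * ?\<phi> y) n = (\<Sum>k=0..n. if k = n then fps_nth (u y) n * fps_nth (?\<phi> y) 0 else 0)"
        unfolding fps_mult_nth
        by (rule sum.cong) (use less.IH[OF _ y] in \<open>auto simp: le_less\<close>)
      also have "\<dots> = fps_nth (u y) n * fps_nth (?\<phi> y) 0" by simp
      also have "fps_nth (?\<phi> y) 0 = of_bool (\<sigma> + (y - x) = \<sigma>)"
        by (simp only: coef_lmonom_\<Omega>_nth_0) simp
      finally show "fps_nth (u y * ?\<phi> y) n = (if y = x then fps_nth (u y) n else 0)" by simp
    qed
    also have "\<dots> = fps_nth (u x) n" using less.prems finite_level by simp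
    finally show ?case by simp
  qed
qed

theorem card_level_mono:
  assumes i: "0 < i" "2 * i + 1 \<le> card J"
  shows "card (level i) \<le> card (level (i + 1))"
proof (rule ccontr)
  \<comment> \<open>By symmetry level \<open>e\<close> has the size of level \<open>i + 1\<close>.
    Points of level \<open>e\<close> complement a height-1 point times a point of level
    \<open>i\<close> to total height \<open>card J\<close>.\<close>
  define e where "e = card J - (i + 1)"
  assume "\<not> card (level i) \<le> card (level (i + 1))"
  then have less: "card (level e) < card (level i)"
    using card_level_symmetric[of "i + 1"] i by (simp add: e_def)
  \<comment> \<open>This number of additional forms makes \<open>card (J \<union> E)\<close> equal
    to \<open>2 * (card J - i)\<close>, twice the height of the complements of level
    \<open>i\<close>.\<close>
  obtain E where E: "finite E" "card E = card J - 2 * i" "E \<subseteq> UNIV - J"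
    using infinite_arbitrarily_large[of "UNIV - J"] finite_J by (metis Diff_infinite_finite infinite_UNIV_nat)
  then have "E \<noteq> {}" using i by auto
  then obtain s where s: "s \<in> E" by blast
  \<comment> \<open>One equation for each point of level \<open>e\<close> and one unknown for each
    point of level \<open>i\<close>: a nonzero \<open>u\<close> exists whose product with a single
    additional form pairs to 0 with level \<open>e\<close>.\<close>
  obtain u x where u: "x \<in> level i" "u x \<noteq> 0"
    "\<And>y. y \<in> level e \<Longrightarrow>
      (\<Sum>x\<in>level i. coef 0 (generic_part s * lmonom x * lmonom y * \<Omega>) * u x) = 0"
    using underdetermined_system[OF finite_level finite_level less,
        of "\<lambda>y x. coef 0 (generic_part s * lmonom x * lmonom y * \<Omega>)"] by blast
  define U where "U = (\<Sum>x\<in>level i. scalar (u x) * lmonom x)"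
  let ?\<Pi> = "\<Prod>s\<in>E. generic_part s"
  let ?f = "generic_part s * U"
  have on_level: "coef 0 (?f * lmonom y * \<Omega>) = 0" if "y \<in> level e" for y
  proof -
    have "?f * lmonom y * \<Omega> =
        (\<Sum>x\<in>level i. scalar (u x) * (generic_part s * lmonom x * lmonom y * \<Omega>))"
      by (simp add: U_def sum_distrib_left sum_distrib_right ac_simps)
    then show ?thesis using u(3)[OF that] by (simp add: coef_sum coef_scalar_mult mult.commute)
  qed
  have "supported {z. 0 \<le> \<kappa> j z} U" if "j \<in> J" for j
    unfolding U_def using that
    by (intro supported_sum supported_scalar_mult supported_lmonom) (auto dest: levelD)
  then have supp: "supported {z. 0 \<le> \<kappa> j z} ?f" if "j \<in> J" for j
    using that by (intro supported_mult[OF generic_part_supported]) (auto simp: \<kappa>_simps)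
  \<comment> \<open>The vanishing extends from level \<open>e\<close> to all interior points of that
    height.\<close>
  have int: "coef 0 (?f * lmonom z * \<Omega>) = 0"
    if "z \<in> interior_points" "ht z = real e" for z
    by (rule propagate_to_interior[OF supp _ on_level that]) (use i in \<open>auto simp: e_def\<close>)
  \<comment> \<open>The heights match: \<open>i\<close> plus the \<open>card J - 2 * i - 1\<close>
    remaining forms gives \<open>e\<close>.\<close>
  have "coef 0 (?f * (lmonom x * (\<Prod>s\<in>E - {s}. generic_part s)) * \<Omega>) = 0" if "x \<in> level i" for x
  proof (rule generic_product_eq_0[OF _ int])
    show "x \<in> interior_points" by (rule level_interior[OF that i(1)])
    show "ht x + real (card (E - {s})) = real e"
      using that s E i by (simp add: e_def levelD of_nat_diff)
  qed (use E in auto)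
  moreover have "U * U * ?\<Pi> * \<Omega>
      = (\<Sum>x\<in>level i. scalar (u x) * (?f * (lmonom x * (\<Prod>s\<in>E - {s}. generic_part s)) * \<Omega>))"
  proof -
    have "U * U * ?\<Pi> * \<Omega> = U * (?f * (\<Prod>s\<in>E - {s}. generic_part s) * \<Omega>)"
      using s E by (simp add: prod.remove[of E s] ac_simps)
    also have "\<dots> = (\<Sum>x\<in>level i. scalar (u x) * lmonom x) * (?f * (\<Prod>s\<in>E - {s}. generic_part s) * \<Omega>)"
      by (simp only: U_def)
    also have "\<dots> = (\<Sum>x\<in>level i. scalar (u x) * (?f * (lmonom x * (\<Prod>s\<in>E - {s}. generic_part s)) * \<Omega>))"
      unfolding sum_distrib_right by (rule sum.cong) (simp_all only: ac_simps)
    finally show ?thesis .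
  qed
  ultimately have "coef 0 (U * U * ?\<Pi> * \<Omega>) = 0" by (simp add: coef_sum coef_scalar_mult)
  \<comment> \<open>Multiplying by the forms of \<open>J\<close> and one more
    \<open>\<Omega>\<close> changes nothing, and exhibits the square to be treated as a
    constant.\<close>
  moreover have "U * U * ?\<Pi> * \<Omega> = (\<Prod>s\<in>J \<union> E. form s) * ((U * \<Omega>) * (U * \<Omega>))"
  proof -
    have "(\<Prod>s\<in>J \<union> E. form s) = (\<Prod>s\<in>J. form s) * (\<Prod>s\<in>E. form s)"
      using E finite_J by (intro prod.union_disjoint) auto
    also have "(\<Prod>s\<in>E. form s) = ?\<Pi>" using E by (intro prod.cong) (auto simp: form_def)
    finally have "(\<Prod>s\<in>J \<union> E. form s) * ((U * \<Omega>) * (U * \<Omega>))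
        = ((\<Prod>s\<in>J. form s) * \<Omega>) * (U * U * ?\<Pi> * \<Omega>)" by (simp only: ac_simps)
    then show ?thesis by (simp add: prod_form_mult_\<Omega>)
  qed
  ultimately have "coef 0 ((\<Prod>s\<in>J \<union> E. form s) * ((U * \<Omega>) * (U * \<Omega>))) = 0" by simp
  moreover have "card (J \<union> E) = 2 * (card J - i)"
    using E i finite_J by (subst card_Un_disjoint) auto
  ultimately have dual: "coef 0 (lmonom y * (U * \<Omega>)) = 0" if "y \<in> level (card J - i)" for y
    using that E finite_J i by (intro coef_level_eq_0[of "J \<union> E" "card J - i"]) auto
  have "u x = 0"
  proof (rule nondegenerate[of i u, OF _ u(1), folded U_def])
    fix x assume "x \<in> level i"
    then show "coef 0 (lmonom (\<sigma> - x) * (U * \<Omega>)) = 0" by (rule dual[OF \<sigma>_diff_level]) (use i in auto)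
  qed
  then show False using u by simp
qed

end

section \<open>Lattice simplices\<close>

text \<open>The coordinate functionals of a lattice basis are bounded on \<open>S\<close>, which
  leaves finitely many integral coefficient vectors.\<close>

lemma finite_lattice_Int_bounded:
  fixes L :: "'a::euclidean_space set"
  assumes "is_lattice L" "bounded S"
  shows "finite (L \<inter> S)"
proof -
  obtain B :: "'a set" where B: "finite B" "independent B"
    "L = {(\<Sum>b\<in>B. real_of_int (c b) *\<^sub>R b) | c. True}"
    using assms(1) by (auto simp: is_lattice_def lattice_basis_def)
  have "\<exists>g. linear g \<and> (\<forall>x\<in>B. g x = (of_bool (x = b) :: real))" for b
    by (rule linear_independent_extend[OF B(2)])
  then obtain g where g: "\<And>b. linear (g b)" "\<And>b x. x \<in> B \<Longrightarrow> g b x = (of_bool (x = b) :: real)"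
    by metis
  have "\<exists>K. \<forall>x\<in>S. \<bar>g b x\<bar> \<le> K" for b
    using bounded_linear_image[OF assms(2) linear_conv_bounded_linear[THEN iffD1, OF g(1)[of b]]]
    by (auto simp: bounded_iff)
  then obtain K where K: "\<And>b x. x \<in> S \<Longrightarrow> \<bar>g b x\<bar> \<le> K b" by metis
  have "L \<inter> S \<subseteq> (\<lambda>c. \<Sum>b\<in>B. real_of_int (c b) *\<^sub>R b) ` (\<Pi>\<^sub>E b\<in>B. {- \<lceil>K b\<rceil>..\<lceil>K b\<rceil>})"
  proof
    fix x assume x: "x \<in> L \<inter> S"
    then obtain c where c: "x = (\<Sum>b\<in>B. real_of_int (c b) *\<^sub>R b)" using B(3) by auto
    have "c b \<in> {- \<lceil>K b\<rceil>..\<lceil>K b\<rceil>}" if b: "b \<in> B" for b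
    proof -
      have "g b x = (\<Sum>b'\<in>B. of_int (c b') * g b b')"
        by (simp add: c linear_sum[OF g(1)] linear_scale[OF g(1)])
      also have "\<dots> = (\<Sum>b'\<in>B. if b' = b then of_int (c b) else 0)"
        by (rule sum.cong) (auto simp: g(2))
      also have "\<dots> = c b" using B(1) b by simp
      finally have "\<bar>of_int (c b)\<bar> \<le> K b" using K[of x b] x by simp
      then show ?thesis by (simp add: abs_le_iff le_ceiling_iff) linarith
    qed
    then have "restrict c B \<in> (\<Pi>\<^sub>E b\<in>B. {- \<lceil>K b\<rceil>..\<lceil>K b\<rceil>})" by auto
    moreover have "x = (\<Sum>b\<in>B. real_of_int (restrict c B b) *\<^sub>R b)"
      unfolding c by (rule sum.cong) auto
    ultimately show "x \<in> (\<lambda>c. \<Sum>b\<in>B. real_of_int (c b) *\<^sub>R b) ` (\<Pi>\<^sub>E b\<in>B. {- \<lceil>K b\<rceil>..\<lceil>K b\<rceil>})"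
      by blast
  qed
  moreover have "finite (\<Pi>\<^sub>E b\<in>B. {- \<lceil>K b\<rceil>..\<lceil>K b\<rceil>})" using B(1) by (intro finite_PiE) auto
  ultimately show ?thesis using finite_surj by blast
qed

text \<open>The dimension forces the \<open>d + 1\<close> points \<open>v j\<close> to be distinct
  and affinely independent. They are then extreme points of the hull, so they belong to every set
  with this hull, in particular to one inside \<open>M\<close>.\<close>

lemma lattice_simplex_vertices:
  fixes v :: "nat \<Rightarrow> 'a::euclidean_space"
  assumes "\<Delta> = convex hull (v ` {0..d})" "lattice_simplex M d \<Delta>"
  shows "aff_dim \<Delta> = d" "inj_on v {0..d}" "\<not> affine_dependent (v ` {0..d})" "v ` {0..d} \<subseteq> M"
proof -
  show dim: "aff_dim \<Delta> = d" using assms(2) by (auto simp: lattice_simplex_def dest: aff_dim_simplex)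
  then have dim': "aff_dim (v ` {0..d}) = d" by (simp add: assms(1) aff_dim_convex_hull)
  have "int d \<le> int (card (v ` {0..d})) - 1"
    using aff_dim_le_card[of "v ` {0..d}"] dim' by simp
  then have card: "card (v ` {0..d}) = d + 1" using card_image_le[of "{0..d}" v] by simp
  then show "inj_on v {0..d}" by (intro eq_card_imp_inj_on) auto
  show ind: "\<not> affine_dependent (v ` {0..d})"
    using card dim' by (simp add: affine_independent_iff_card)
  obtain S where S: "S \<subseteq> M" "\<Delta> = convex hull S"
    using assms(2) by (auto simp: lattice_simplex_def lattice_polytope_def)
  show "v ` {0..d} \<subseteq> M"
  proof
    fix x assume "x \<in> v ` {0..d}"
    then have "x extreme_point_of (convex hull S)"
      using extreme_point_of_convex_hull_affine_independent[OF ind, of x] assms(1) S(2) by simp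
    then show "x \<in> M" using extreme_point_of_convex_hull S(1) by blast
  qed
qed

text \<open>Affine independence of the \<open>v j\<close> is linear independence of the
  \<open>(v j, 1)\<close>. Dual functionals extend to the whole space; only their values on the span
  of the cone carry meaning.\<close>

lemma barycentric_functionals:
  fixes v :: "nat \<Rightarrow> 'a::euclidean_space"
  assumes "inj_on v {0..d}" "\<not> affine_dependent (v ` {0..d})"
  obtains \<kappa> :: "nat \<Rightarrow> 'a \<times> real \<Rightarrow> real"
  where "\<And>j. linear (\<kappa> j)" "\<And>i j. i \<le> d \<Longrightarrow> j \<le> d \<Longrightarrow> \<kappa> i (v j, 1) = of_bool (i = j)"
proof -
  let ?A = "v ` {0..d}" and ?h = "\<lambda>x. (x, 1 :: real)"
  have "independent (?h ` ?A)"
  proof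
    assume "dependent (?h ` ?A)"
    then obtain u where u: "\<exists>x\<in>?h ` ?A. u x \<noteq> 0" "(\<Sum>x\<in>?h ` ?A. u x *\<^sub>R x) = 0"
      by (subst (asm) dependent_finite) auto
    have "(\<Sum>x\<in>?A. u (?h x) *\<^sub>R ?h x) = 0"
      using u(2) by (subst (asm) sum.reindex) (auto simp: inj_on_def)
    then have "(\<Sum>x\<in>?A. u (?h x)) = 0" "(\<Sum>x\<in>?A. u (?h x) *\<^sub>R x) = 0"
      by (auto simp: prod_eq_iff fst_sum snd_sum)
    then have "affine_dependent ?A"
      using u(1) by (subst affine_dependent_explicit_finite) (auto intro!: exI[of _ "\<lambda>x. u (?h x)"])
    then show False using assms(2) by blast
  qed
  then have "\<exists>g. linear g \<and> (\<forall>x\<in>?h ` ?A. g x = (of_bool (x = ?h (v i)) :: real))" for i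
    by (rule linear_independent_extend)
  then obtain \<kappa> where \<kappa>: "\<And>i. linear (\<kappa> i)"
    "\<And>i x. x \<in> ?h ` ?A \<Longrightarrow> \<kappa> i x = (of_bool (x = ?h (v i)) :: real)" by metis
  show thesis
    by (rule that[of \<kappa>]) (use \<kappa> assms(1) in \<open>auto simp: inj_on_eq_iff\<close>)
qed

text \<open>Multiplication by \<open>1 - fps_X\<close> lowers \<open>d\<close> by Pascal's
  rule.\<close>

lemma binomial_series:
  "Abs_fps (\<lambda>k. of_nat ((k + d) choose k)) * (1 - fps_X) ^ (d + 1) = (1 :: rat fps)"
proof (induction d)
  case 0
  show ?case by (rule fps_ext) (simp add: algebra_simps fps_one_nth)
next
  case (Suc d)
  have "Abs_fps (\<lambda>k. of_nat ((k + Suc d) choose k)) * (1 - fps_X)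
      = Abs_fps (\<lambda>k. of_nat ((k + d) choose k) :: rat)"
  proof (rule fps_ext)
    fix n
    show "fps_nth (Abs_fps (\<lambda>k. of_nat ((k + Suc d) choose k)) * (1 - fps_X)) n
      = fps_nth (Abs_fps (\<lambda>k. of_nat ((k + d) choose k) :: rat)) n"
      by (cases n) (simp_all add: algebra_simps)
  qed
  then show ?case using Suc.IH by (simp only: add_Suc power_Suc mult.assoc[symmetric])
qed

locale simplex_coordinates =
  fixes M :: "'a::euclidean_space set" and v :: "nat \<Rightarrow> 'a" and d :: nat
    and \<kappa> :: "nat \<Rightarrow> 'a \<times> real \<Rightarrow> real"
  assumes lattice_M: "is_lattice M"
    and vertices_in_M: "\<And>j. j \<le> d \<Longrightarrow> v j \<in> M"
    and linear: "\<And>j. linear (\<kappa> j)"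
    and \<kappa>_vertex: "\<And>i j. i \<le> d \<Longrightarrow> j \<le> d \<Longrightarrow> \<kappa> i (v j, 1) = of_bool (i = j)"
begin

section \<open>Coordinates on the cone over the simplex\<close>

definition w :: "nat \<Rightarrow> 'a \<times> real" where
  "w j = (v j, 1)"

definition N :: "nat set \<Rightarrow> ('a \<times> real) set" where
  "N J = span (w ` J) \<inter> (M \<times> \<int>)"

lemma span_expansion:
  assumes "J \<subseteq> {0..d}" "p \<in> span (w ` J)"
  shows "p = (\<Sum>j\<in>J. \<kappa> j p *\<^sub>R w j)"
  using assms(2)
proof (induction rule: span_induct_alt)
  case base
  then show ?case by (simp add: linear_0[OF linear])
next
  case (step c x y)
  obtain i where i: "i \<in> J" "x = w i" using step by auto
  have "finite J" using assms(1) finite_subset by blast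
  have "(\<Sum>j\<in>J. \<kappa> j x *\<^sub>R w j) = (\<Sum>j\<in>J. if j = i then w i else 0)"
    using i assms(1) by (intro sum.cong) (auto simp: w_def \<kappa>_vertex subset_iff zero_prod_def)
  also have "\<dots> = x" using i \<open>finite J\<close> by simp
  finally have "c *\<^sub>R (\<Sum>j\<in>J. \<kappa> j x *\<^sub>R w j) = c *\<^sub>R x" by (rule arg_cong)
  then show ?case using step
    by (simp add: linear_add[OF linear] linear_scale[OF linear] scaleR_add_left sum.distrib
        scaleR_sum_right)
qed

lemma span_expansion_sum: "(\<Sum>j\<in>J. c j *\<^sub>R w j) \<in> span (w ` J)"
  by (intro span_sum span_scale span_base) auto

lemma \<kappa>_sum:
  assumes "J \<subseteq> {0..d}" "i \<le> d"
  shows "\<kappa> i (\<Sum>j\<in>J. c j *\<^sub>R w j) = (if i \<in> J then c i else 0)"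
proof -
  have "finite J" using assms(1) finite_subset by blast
  have "\<kappa> i (\<Sum>j\<in>J. c j *\<^sub>R w j) = (\<Sum>j\<in>J. if j = i then c i else 0)"
    unfolding linear_sum[OF linear] using assms
    by (intro sum.cong) (auto simp: w_def \<kappa>_vertex linear_scale[OF linear] subset_iff simp del: scaleR_Pair)
  then show ?thesis using \<open>finite J\<close> by simp
qed

lemma \<kappa>_outside: "J \<subseteq> {0..d} \<Longrightarrow> p \<in> span (w ` J) \<Longrightarrow> i \<le> d \<Longrightarrow> i \<notin> J \<Longrightarrow> \<kappa> i p = 0"
  using span_expansion[of J p] \<kappa>_sum[of J i "\<lambda>j. \<kappa> j p"] by simp

lemma snd_eq_sum: "J \<subseteq> {0..d} \<Longrightarrow> p \<in> span (w ` J) \<Longrightarrow> (\<Sum>j\<in>J. \<kappa> j p) = snd p"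
  using arg_cong[OF span_expansion[of J p], of snd] by (simp add: snd_sum w_def)

lemma N_coordinates:
  assumes "J \<subseteq> {0..d}"
  shows "lattice_coordinates (N J) J \<kappa> w"
proof (rule lattice_coordinates.intro)
  show "finite J" using assms finite_subset by blast
  show "linear (\<kappa> j)" for j by (rule linear)
  show "0 \<in> N J" using is_lattice_zero[OF lattice_M] by (auto simp: N_def zero_prod_def[symmetric] mem_Times_iff span_zero)
  show "p + q \<in> N J" if "p \<in> N J" "q \<in> N J" for p q
    using that is_lattice_add[OF lattice_M] by (auto simp: N_def mem_Times_iff intro: span_add)
  show "- p \<in> N J" if "p \<in> N J" for p
    using that is_lattice_scale[OF lattice_M, of "fst p" "-1"] by (auto simp: N_def mem_Times_iff intro: span_neg)
  show "w j \<in> N J" if "j \<in> J" for j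
    using that assms vertices_in_M[of j] by (auto simp: N_def w_def intro: span_base)
  show "\<kappa> i (w j) = of_bool (i = j)" if "i \<in> J" "j \<in> J" for i j
    using that assms by (simp add: w_def \<kappa>_vertex subset_iff)
  show "p = 0" if "p \<in> N J" "\<And>j. j \<in> J \<Longrightarrow> \<kappa> j p = 0" for p
    using span_expansion[OF assms, of p] that by (simp add: N_def)
  show "(\<Sum>j\<in>J. \<kappa> j p) \<in> \<int>" if "p \<in> N J" for p
    using snd_eq_sum[OF assms, of p] that by (auto simp: N_def)
qed

sublocale lattice_coordinates "N {0..d}" "{0..d}" \<kappa> w
  by (rule N_coordinates) simp

lemma ht_eq_snd: "p \<in> N {0..d} \<Longrightarrow> ht p = snd p"
  by (simp add: ht_def snd_eq_sum N_def)

lemma box_span: "p \<in> box \<Longrightarrow> p \<in> span (w ` {0..d})"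
  unfolding box_def by (auto simp: N_def)

section \<open>Lattice points of dilates and the h*-vector\<close>

definition points :: "nat \<Rightarrow> ('a \<times> real) set" where
  "points n = {p \<in> N {0..d}. snd p = real n \<and> (\<forall>j\<le>d. 0 \<le> \<kappa> j p)}"

abbreviation \<Delta> :: "'a set" where
  "\<Delta> \<equiv> convex hull (v ` {0..d})"

lemma mem_dilate_iff: "y \<in> dilate n \<Delta> \<inter> M \<longleftrightarrow> (y, real n) \<in> points n"
proof
  assume "y \<in> dilate n \<Delta> \<inter> M"
  then obtain x where x: "x \<in> \<Delta>" "y = real n *\<^sub>R x" "y \<in> M" by (auto simp: dilate_def)
  \<comment> \<open>The points with nonnegative coordinates form a convex set that contains the
    vertices, hence the simplex.\<close>
  let ?C = "{x. (x, 1) \<in> span (w ` {0..d}) \<and> (\<forall>j\<le>d. 0 \<le> \<kappa> j (x, 1))}"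
  have "convex ?C"
  proof (rule convexI)
    fix x y a b assume xy: "x \<in> ?C" "y \<in> ?C" "0 \<le> a" "0 \<le> b" "a + b = (1::real)"
    have "(a *\<^sub>R x + b *\<^sub>R y, 1) = a *\<^sub>R (x, 1) + b *\<^sub>R (y, 1 :: real)" using xy by simp
    then show "a *\<^sub>R x + b *\<^sub>R y \<in> ?C"
      using xy by (auto simp: linear_add[OF linear] linear_scale[OF linear] simp del: scaleR_Pair add_Pair
          intro!: span_add span_scale)
  qed
  moreover have "v ` {0..d} \<subseteq> ?C"
    using \<kappa>_vertex by (auto intro: span_base simp: w_def)
  ultimately have "\<Delta> \<subseteq> ?C" by (rule hull_minimal[rotated])
  then have "x \<in> ?C" using x by blast
  moreover have "(y, real n) = real n *\<^sub>R (x, 1)" using x by simp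
  ultimately have "(y, real n) \<in> span (w ` {0..d})" "\<forall>j\<le>d. 0 \<le> \<kappa> j (y, real n)"
    by (auto simp: linear_scale[OF linear] span_scale simp del: scaleR_Pair)
  then show "(y, real n) \<in> points n" using x(3) by (simp add: points_def N_def)
next
  assume p: "(y, real n) \<in> points n"
  let ?k = "\<lambda>j. \<kappa> j (y, real n)"
  have sp: "(y, real n) \<in> span (w ` {0..d})" and pos: "\<And>j. j \<le> d \<Longrightarrow> 0 \<le> ?k j" and M: "y \<in> M"
    using p by (auto simp: points_def N_def)
  have sum: "(\<Sum>j=0..d. ?k j) = real n" using snd_eq_sum[OF _ sp] by simp
  have y: "y = (\<Sum>j=0..d. ?k j *\<^sub>R v j)"
    using arg_cong[OF span_expansion[OF _ sp], of fst] by (simp add: fst_sum w_def)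
  have "\<exists>x\<in>\<Delta>. y = real n *\<^sub>R x"
  \<comment> \<open>For \<open>n = 0\<close> one cannot divide by \<open>n\<close>; nonnegative
    coordinates with sum 0 give \<open>y = 0\<close> directly.\<close>
  proof (cases "n = 0")
    case True
    then have "?k j = 0" if "j \<le> d" for j
      using sum pos that sum_nonneg_eq_0_iff[of "{0..d}" ?k] by auto
    then have "y = 0" by (subst y) simp
    moreover have "v 0 \<in> \<Delta>" by (rule hull_inc) auto
    ultimately show ?thesis using True by auto
  next
    case False
    have "(\<Sum>j\<in>{0..d}. (?k j / real n) *\<^sub>R v j) \<in> \<Delta>"
      using False pos sum
      by (intro convex_sum) (auto intro: hull_inc simp: convex_convex_hull sum_divide_distrib[symmetric])
    moreover have "y = real n *\<^sub>R (\<Sum>j\<in>{0..d}. (?k j / real n) *\<^sub>R v j)"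
      using False by (subst y) (simp add: scaleR_sum_right)
    ultimately show ?thesis by blast
  qed
  then show "y \<in> dilate n \<Delta> \<inter> M" using M by (auto simp: dilate_def)
qed

lemma card_dilate: "card (dilate n \<Delta> \<inter> M) = card (points n)"
proof (rule bij_betw_same_card[OF bij_betwI])
  show "(\<lambda>y. (y, real n)) \<in> dilate n \<Delta> \<inter> M \<rightarrow> points n" using mem_dilate_iff by blast
  show "fst \<in> points n \<rightarrow> dilate n \<Delta> \<inter> M"
  proof
    fix p assume "p \<in> points n"
    then have "(fst p, real n) \<in> points n" by (cases p) (simp add: points_def)
    then show "fst p \<in> dilate n \<Delta> \<inter> M" by (simp only: mem_dilate_iff)
  qed
qed (auto simp: points_def)

text \<open>Coordinates in the unit interval bound both the norm of the first component and the
  height.\<close>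

lemma finite_box: "finite box"
proof -
  define R where "R = (\<Sum>j=0..d. norm (v j))"
  have "box \<subseteq> (M \<inter> cball 0 R) \<times> real ` {0..d + 1}"
  proof
    fix p assume p: "p \<in> box"
    then have sp: "p \<in> span (w ` {0..d})" and k: "\<And>j. j \<le> d \<Longrightarrow> 0 \<le> \<kappa> j p \<and> \<kappa> j p < 1"
      and M: "fst p \<in> M" "snd p \<in> \<int>"
      unfolding box_def by (auto simp: N_def)
    have "fst p = (\<Sum>j=0..d. \<kappa> j p *\<^sub>R v j)"
      using arg_cong[OF span_expansion[OF _ sp], of fst] by (simp add: fst_sum w_def)
    moreover have "norm (\<Sum>j=0..d. \<kappa> j p *\<^sub>R v j) \<le> R"
      unfolding R_def using k by (intro sum_norm_le) (auto intro!: mult_left_le_one_le simp: less_imp_le)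
    ultimately have "fst p \<in> cball 0 R" by simp
    moreover have "snd p \<in> real ` {0..d + 1}"
    proof -
      have "0 \<le> (\<Sum>j=0..d. \<kappa> j p)" "(\<Sum>j=0..d. \<kappa> j p) \<le> (\<Sum>j=0..d. 1)"
        by (rule sum_nonneg sum_mono; use k in \<open>simp add: less_imp_le\<close>)+
      then have "0 \<le> snd p" "snd p \<le> real d + 1"
        using snd_eq_sum[OF order_refl sp] by auto
      moreover obtain z where "snd p = of_int z" using M(2) by (auto elim: Ints_cases)
      ultimately have "snd p = real (nat z)" "nat z \<le> d + 1" by auto
      then show ?thesis by auto
    qed
    ultimately show "p \<in> (M \<inter> cball 0 R) \<times> real ` {0..d + 1}" using M(1) by (cases p) auto
  qed
  then show ?thesis
    using finite_lattice_Int_bounded[OF lattice_M bounded_cball] finite_subset by blast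
qed

text \<open>The half-open box tiles the cone: a lattice point is uniquely a box point plus natural
  multiples of the \<open>w j\<close>, given by the fractional parts and floors of its coordinates.
  The multiples form a list of length \<open>d + 1\<close> with sum \<open>n - i\<close>, which the
  binomial coefficient counts.\<close>

lemma card_points:
  "card (points n) = (\<Sum>i=0..n. card (level i) * ((n - i + d) choose (n - i)))"
proof -
  let ?C = "\<lambda>k. {l :: nat list. length l = d + 1 \<and> sum_list l = k}"
  let ?f = "\<lambda>(i, x, l). x + (\<Sum>j\<in>{0..d}. real (l ! j) *\<^sub>R w j)"
  have fin: "finite (?C k)" for k
    by (rule finite_subset[OF _ finite_lists_length_eq[of "{0..k}" "d + 1"]])
       (auto intro: member_le_sum_list)
  have \<kappa>f: "\<kappa> j (x + (\<Sum>j\<in>{0..d}. real (l ! j) *\<^sub>R w j)) = \<kappa> j x + real (l ! j)" if "j \<le> d" for j x and l :: "nat list"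
    using that by (simp add: linear_add[OF linear] \<kappa>_sum)
  have snd_f: "snd (x + (\<Sum>j\<in>{0..d}. real (l ! j) *\<^sub>R w j)) = snd x + real (sum_list l)"
    if "length l = d + 1" for x and l :: "nat list"
    using that by (simp add: snd_sum w_def sum_list_sum_nth atLeast0LessThan lessThan_Suc_atMost atLeast0AtMost)
  have "bij_betw ?f (SIGMA i:{0..n}. level i \<times> ?C (n - i)) (points n)"
  proof (rule bij_betw_imageI)
    show "inj_on ?f (SIGMA i:{0..n}. level i \<times> ?C (n - i))"
    proof (rule inj_onI)
      fix a b assume ab: "a \<in> (SIGMA i:{0..n}. level i \<times> ?C (n - i))"
        "b \<in> (SIGMA i:{0..n}. level i \<times> ?C (n - i))" "?f a = ?f b"
      obtain i x l i' x' l' where [simp]: "a = (i, x, l)" "b = (i', x', l')" by (metis surj_pair)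
      have x: "x \<in> level i" "x' \<in> level i'" and l: "length l = d + 1" "length l' = d + 1"
        and eq: "x + (\<Sum>j\<in>{0..d}. real (l ! j) *\<^sub>R w j) = x' + (\<Sum>j\<in>{0..d}. real (l' ! j) *\<^sub>R w j)"
        using ab by auto
      have *: "\<kappa> j x + real (l ! j) = \<kappa> j x' + real (l' ! j)" if "j \<le> d" for j
        using \<kappa>f[OF that, of x l] \<kappa>f[OF that, of x' l'] eq by simp
      \<comment> \<open>Two coordinates in the half-open unit interval that differ by an integer are
        equal.\<close>
      have **: "l ! j = l' ! j" if "j \<le> d" for j
      proof -
        have "0 \<le> \<kappa> j x" "\<kappa> j x < 1" "0 \<le> \<kappa> j x'" "\<kappa> j x' < 1"
          using x that by (auto dest: levelD(3,4)[where j = j])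
        then show ?thesis using *[OF that] by linarith
      qed
      have "l = l'" using l ** by (intro nth_equalityI) auto
      moreover from this have xx: "x = x'" using eq by simp
      moreover have "real i = real i'" using levelD(2)[OF x(1)] levelD(2)[OF x(2)] xx by simp
      ultimately show "a = b" by simp
    qed
    show "?f ` (SIGMA i:{0..n}. level i \<times> ?C (n - i)) = points n"
    proof (intro equalityI subsetI)
      fix p assume "p \<in> ?f ` (SIGMA i:{0..n}. level i \<times> ?C (n - i))"
      then obtain i x l where i: "i \<le> n" and x: "x \<in> level i" and l: "length l = d + 1" "sum_list l = n - i"
        and p: "p = x + (\<Sum>j\<in>{0..d}. real (l ! j) *\<^sub>R w j)" by auto
      have "p \<in> N {0..d}"
        unfolding p by (intro add_in_L sum_in_L of_nat_scale_in_L w_in_L levelD(1)[OF x]) auto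
      moreover have "snd p = real n"
        unfolding p snd_f[OF l(1)] using i l(2) levelD(2)[OF x] ht_eq_snd[OF levelD(1)[OF x]] by simp
      moreover have "0 \<le> \<kappa> j p" if "j \<le> d" for j
        unfolding p \<kappa>f[OF that] using levelD(3)[OF x, of j] that by simp
      ultimately show "p \<in> points n" by (simp add: points_def)
    next
      fix p assume p: "p \<in> points n"
      then have pN: "p \<in> N {0..d}" and pn: "snd p = real n" and pos: "\<And>j. j \<le> d \<Longrightarrow> 0 \<le> \<kappa> j p"
        by (auto simp: points_def)
      define l where "l = map (\<lambda>j. nat \<lfloor>\<kappa> j p\<rfloor>) [0..<d + 1]"
      define x where "x = p - (\<Sum>j\<in>{0..d}. real (l ! j) *\<^sub>R w j)"
      have l: "length l = d + 1" by (simp add: l_def)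
      have lj: "real (l ! j) = of_int \<lfloor>\<kappa> j p\<rfloor>" if "j \<le> d" for j
        using that pos[OF that] by (simp add: l_def del: upt_Suc)
      have px: "p = x + (\<Sum>j\<in>{0..d}. real (l ! j) *\<^sub>R w j)" by (simp add: x_def)
      have xN: "x \<in> N {0..d}"
        unfolding x_def by (intro diff_in_L sum_in_L of_nat_scale_in_L w_in_L pN) auto
      have kx: "\<kappa> j x = frac (\<kappa> j p)" if "j \<le> d" for j
        using \<kappa>f[OF that, of x l] lj[OF that] px by (simp add: frac_def)
      have xb: "x \<in> box" using xN by (auto simp: box_def kx frac_lt_1)
      have sx: "snd x = real n - real (sum_list l)" using snd_f[OF l, of x] px pn by simp
      have "0 \<le> snd x"
        unfolding ht_eq_snd[OF xN, symmetric] ht_def by (intro sum_nonneg) (auto simp: kx)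
      then have i: "snd x = real (n - sum_list l)" "n - sum_list l \<le> n" "sum_list l = n - (n - sum_list l)"
        using sx by auto
      then have "x \<in> level (n - sum_list l)" using xb ht_eq_snd[OF xN] by (simp add: level_def)
      then have "(n - sum_list l, x, l) \<in> (SIGMA i:{0..n}. level i \<times> ?C (n - i))" using i l by auto
      then show "p \<in> ?f ` (SIGMA i:{0..n}. level i \<times> ?C (n - i))"
        by (rule rev_image_eqI) (simp add: px[symmetric])
    qed
  qed
  then have "card (points n) = card (SIGMA i:{0..n}. level i \<times> ?C (n - i))"
    by (simp add: bij_betw_same_card)
  also have "\<dots> = (\<Sum>i=0..n. card (level i \<times> ?C (n - i)))"
    using fin finite_box by (intro card_SigmaI) (auto simp: level_def)
  also have "\<dots> = (\<Sum>i=0..n. card (level i) * ((n - i + d) choose (n - i)))"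
    by (rule sum.cong) (simp_all add: card_cartesian_product card_length_sum_list[of "d + 1"] del: One_nat_def)
  finally show ?thesis .
qed

text \<open>\<open>card_points\<close> is a convolution with the coefficients of the inverse of
  \<open>(1 - fps_X) ^ (d + 1)\<close>.\<close>

lemma hstar_vector_eq:
  assumes "aff_dim \<Delta> = d"
  shows "hstar_vector M \<Delta> = map (\<lambda>i. of_nat (card (level i))) [0..<d + 1]"
proof -
  define h :: "rat poly" where "h = (\<Sum>i\<le>d. monom (of_nat (card (level i))) i)"
  \<comment> \<open>The sum stops at \<open>d\<close> without losing anything, because box points
    have height below \<open>d + 1\<close>.\<close>
  have coeff_h: "coeff h i = of_nat (card (level i))" for i
    using level_empty[of i] by (auto simp: h_def coeff_sum)
  have "ehrhart_series M \<Delta> = fps_of_poly h * Abs_fps (\<lambda>k. of_nat ((k + d) choose k))"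
  proof (rule fps_ext)
    fix n
    show "fps_nth (ehrhart_series M \<Delta>) n =
        fps_nth (fps_of_poly h * Abs_fps (\<lambda>k. of_nat ((k + d) choose k))) n"
      by (simp add: ehrhart_series_def card_dilate card_points fps_mult_nth coeff_h)
  qed
  then have "ehrhart_series M \<Delta> * (1 - fps_X) ^ (d + 1) = fps_of_poly h"
    using binomial_series[of d] by (simp only: mult.assoc mult_1_right)
  moreover have unit: "fps_nth ((1 - fps_X) ^ (d + 1) :: rat fps) 0 \<noteq> 0"
    by (simp add: fps_nth_power_0)
  ultimately have "ehrhart_series M \<Delta> = fps_of_poly h / (1 - fps_X) ^ (d + 1)"
    by (metis fps_nonzero_nth nonzero_mult_div_cancel_right)
  moreover have "degree h \<le> d"
    by (rule degree_le) (use level_empty in \<open>auto simp: coeff_h\<close>)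
  ultimately have "is_hstar_poly M \<Delta> h" using assms by (simp add: is_hstar_poly_def)
  then show ?thesis by (simp add: hstar_vector_def hstar_poly_eqI coeff_h assms del: upt_Suc)
qed

section \<open>Coordinate groups of faces\<close>

lemma cone_lattice_face:
  assumes "J \<subseteq> {0..d}"
  shows "cone_lattice M (face v J) = N J"
proof -
  have "finite J" using assms finite_subset by blast
  have "cone_over (face v J) \<subseteq> span (w ` J)"
    unfolding cone_over_def
  proof (rule hull_minimal)
    have "convex {x. (x, 1) \<in> span (w ` J)}"
    proof (rule convexI)
      fix x y a b assume "x \<in> {x. (x, 1) \<in> span (w ` J)}" "y \<in> {x. (x, 1) \<in> span (w ` J)}"
        and ab: "a + b = (1::real)"
      then have "a *\<^sub>R (x, 1) + b *\<^sub>R (y, 1 :: real) \<in> span (w ` J)" by (intro span_add span_scale) auto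
      then show "a *\<^sub>R x + b *\<^sub>R y \<in> {x. (x, 1) \<in> span (w ` J)}" using ab by simp
    qed
    moreover have "v ` J \<subseteq> {x. (x, 1) \<in> span (w ` J)}" by (auto intro: span_base simp: w_def)
    ultimately have "face v J \<subseteq> {x. (x, 1) \<in> span (w ` J)}"
      unfolding face_def by (rule hull_minimal[rotated])
    then show "face v J \<times> {1} \<subseteq> span (w ` J)" by auto
    show "cone (span (w ` J))" by (simp add: cone_def span_scale)
  qed
  moreover have "w ` J \<subseteq> cone_over (face v J)"
    by (auto simp: cone_over_def face_def w_def intro!: hull_inc)
  ultimately have "span (cone_over (face v J)) = span (w ` J)"
    by (metis span_eq span_superset subset_trans)
  then show ?thesis by (simp add: cone_lattice_def N_def)
qed

lemma coord_map_\<kappa>: "J \<subseteq> {0..d} \<Longrightarrow> p \<in> span (w ` J) \<Longrightarrow> coord_map v J (\<lambda>j\<in>J. \<kappa> j p) = p"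
  using span_expansion[of J p] by (simp add: coord_map_def w_def)

lemma coord_group_mem:
  assumes "J \<subseteq> {0..d}" "p \<in> box" "p \<in> span (w ` J)"
  shows "(\<lambda>j\<in>J. \<kappa> j p) \<in> carrier (coord_group M v J)"
proof -
  have "p \<in> N J" "\<And>j. j \<in> J \<Longrightarrow> 0 \<le> \<kappa> j p \<and> \<kappa> j p < 1"
    using assms unfolding box_def by (auto simp: N_def)
  then show ?thesis
    using coord_map_\<kappa>[OF assms(1,3)] by (auto simp: coord_group_def cone_lattice_face[OF assms(1)])
qed

lemma support_eq_if_full_support:
  assumes J: "J \<subseteq> {0..d}" and full: "full_support M v J"
    and p: "p \<in> box" "p \<in> span (w ` J)" "p \<noteq> 0"
  shows "{j \<in> {0..d}. \<kappa> j p \<noteq> 0} = J"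
proof -
  let ?x = "\<lambda>j\<in>J. \<kappa> j p"
  have "?x \<noteq> \<one>\<^bsub>coord_group M v J\<^esub>"
  proof
    assume eq: "?x = \<one>\<^bsub>coord_group M v J\<^esub>"
    have "\<kappa> j p = 0" if "j \<in> J" for j
      using fun_cong[OF eq, of j] that by (simp add: coord_group_def)
    then show False using span_expansion[OF J p(2)] p(3) by simp
  qed
  then have "coord_supp J ?x = J"
    using full coord_group_mem[OF J p(1,2)] by (simp add: full_support_def)
  moreover have "coord_supp J ?x = {j \<in> J. \<kappa> j p \<noteq> 0}" by (auto simp: coord_supp_def)
  ultimately show ?thesis using \<kappa>_outside[OF J p(2)] J by fastforce
qed

text \<open>The coordinate vector of a box point lies in the coordinate group, so its nonzero
  entries sit at support indices.\<close>

lemma box_in_support_span: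
  assumes "p \<in> box"
  shows "p \<in> span (w ` support_indices M v {0..d})"
proof -
  let ?J = "support_indices M v {0..d}"
  note sp = box_span[OF assms]
  have "{j \<in> {0..d}. \<kappa> j p \<noteq> 0} \<subseteq> ?J"
    using coord_group_mem[OF order_refl assms sp] by (auto simp: support_indices_def coord_supp_def)
  then have "\<kappa> j p *\<^sub>R w j \<in> span (w ` ?J)" if "j \<in> {0..d}" for j
    using that by (cases "\<kappa> j p = 0") (auto intro: span_zero span_scale span_base)
  then have "(\<Sum>j\<in>{0..d}. \<kappa> j p *\<^sub>R w j) \<in> span (w ` ?J)" by (rule span_sum)
  then show ?thesis using span_expansion[OF order_refl sp] by simp
qed

text \<open>The summands from the integer decomposition property have nonnegative coordinates
  bounded by those of \<open>p\<close>. They are therefore below 1, and the summands stay in the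
  box.\<close>

lemma level_generated:
  assumes "IDP M \<Delta>" and p: "p \<in> level n" and n: "n > 0"
  shows "\<exists>f. (\<forall>i<n. f i \<in> level 1) \<and> p = (\<Sum>i<n. f i)"
proof -
  note pD = levelD[OF p]
  have "p \<in> points n" using pD ht_eq_snd[of p] by (auto simp: points_def)
  moreover have pn: "p = (fst p, real n)" using pD(1,2) ht_eq_snd[of p] by (simp add: prod_eq_iff)
  ultimately have "fst p \<in> dilate n \<Delta> \<inter> M" by (simp only: mem_dilate_iff)
  with assms(1) n have "\<exists>z :: nat \<Rightarrow> 'a. (\<forall>i<n. z i \<in> \<Delta> \<inter> M) \<and> fst p = (\<Sum>i<n. z i)"
    unfolding IDP_def by (elim allE[of _ n] impE bspec)
  then obtain z where z: "\<And>i. i < n \<Longrightarrow> z i \<in> \<Delta> \<inter> M" "fst p = (\<Sum>i<n. z i)"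
    by metis
  define f where "f = (\<lambda>i. (z i, 1 :: real))"
  have p_sum: "p = (\<Sum>i<n. f i)" by (subst pn) (simp add: f_def z(2) prod_eq_iff fst_sum snd_sum)
  have f: "f i \<in> points 1" if "i < n" for i
    using z(1)[OF that] mem_dilate_iff[of "z i" 1] by (simp add: f_def dilate_def)
  have "\<kappa> j (f i) < 1" if "i < n" "j \<le> d" for i j
  proof -
    have "\<kappa> j (f i) \<le> (\<Sum>i<n. \<kappa> j (f i))"
      using that f by (intro member_le_sum) (auto simp: points_def)
    also have "\<dots> = \<kappa> j p" unfolding p_sum by (simp add: linear_sum[OF linear])
    also have "\<dots> < 1" using pD(4)[of j] that by simp
    finally show ?thesis .
  qed
  then have "f i \<in> level 1" if "i < n" for i
    using f[OF that] that ht_eq_snd[of "f i"] by (auto simp: level_def box_def points_def)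
  then show ?thesis using p_sum by blast
qed

text \<open>The sequence increases up to half of \<open>card J\<close> by
  \<open>card_level_mono\<close> and then decreases by symmetry; the exceptional entry at 0 is
  checked separately.\<close>

lemma unimodal_hstar:
  assumes dim: "aff_dim \<Delta> = d" and IDP: "IDP M \<Delta>"
    and J: "J \<subseteq> {0..d}" "\<And>p. p \<in> box \<Longrightarrow> p \<noteq> 0 \<Longrightarrow> {j \<in> {0..d}. \<kappa> j p \<noteq> 0} = J"
  shows "unimodal (hstar_vector M \<Delta>)"
proof (cases "level 1 = {}")
  case True
  \<comment> \<open>Without box points of height 1 there are none of positive height, and only the
    entry at 0 is nonzero.\<close>
  have "level n = {}" if "n > 0" for n
    using level_generated[OF IDP _ that] True that by blast
  then show ?thesis
    unfolding hstar_vector_eq[OF dim] unimodal_def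
    by (intro exI[of _ 0]) (simp del: upt_Suc)
next
  case False
  interpret F: lattice_coordinates "N J" J \<kappa> w by (rule N_coordinates[OF J(1)])
  have NJ: "N J \<subseteq> N {0..d}"
    using span_mono[of "w ` J" "w ` {0..d}"] J(1) by (auto simp: N_def)
  \<comment> \<open>All box points lie over the face of \<open>J\<close>, so passing to the lattice
    of that face loses nothing.\<close>
  have box: "F.box = box"
  proof (intro equalityI subsetI)
    fix p assume p: "p \<in> F.box"
    then have "\<kappa> j p = 0" if "j \<le> d" "j \<notin> J" for j
      using p \<kappa>_outside[OF J(1) _ that] unfolding F.box_def by (auto simp: N_def)
    then show "p \<in> box" using p NJ by (fastforce simp: F.box_def box_def)
  next
    fix p assume p: "p \<in> box"
    have "p \<in> span (w ` J)"
    proof (cases "p = 0")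
      case False
      note sp = box_span[OF p]
      have "(\<Sum>j\<in>{0..d}. \<kappa> j p *\<^sub>R w j) = (\<Sum>j\<in>J. \<kappa> j p *\<^sub>R w j)"
        using J(1) J(2)[OF p False] by (intro sum.mono_neutral_right) auto
      then show ?thesis using span_expansion[OF order_refl sp] span_expansion_sum[where J = J] by metis
    qed (simp add: span_zero)
    then show "p \<in> F.box" using p J(1) unfolding F.box_def box_def by (auto simp: N_def)
  qed
  have level: "F.level n = level n" for n
  proof -
    have "F.ht p = ht p" if "p \<in> box" for p
    proof -
      have "p \<in> F.box" using that by (simp only: box)
      then have p: "p \<in> N J" "p \<in> N {0..d}" using NJ by (auto simp: F.box_def)
      then show ?thesis using snd_eq_sum[OF J(1), of p] ht_eq_snd[of p] by (simp add: F.ht_def N_def)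
    qed
    then show ?thesis by (auto simp: F.level_def level_def box)
  qed
  interpret F: full_support_coordinates "N J" J \<kappa> w
  proof
    show "finite F.box" by (simp add: box finite_box)
    show "\<kappa> j p \<noteq> 0" if "p \<in> F.box" "p \<noteq> 0" "j \<in> J" for p j
      using that J(2)[of p] by (auto simp: box)
    show "\<exists>f. (\<forall>i<n. f i \<in> F.level 1) \<and> p = (\<Sum>i<n. f i)" if "p \<in> F.level n" "n > 0" for p n
      using that level_generated[OF IDP] by (simp only: level)
  qed
  let ?D = "card J" and ?h = "\<lambda>i. card (level i)"
  have D: "?D \<le> d + 1" using card_mono[OF _ J(1)] by simp
  have empty: "?h i = 0" if "?D \<le> i" "0 < i" for i using F.level_empty[OF that] by (simp add: level)
  have D2: "2 \<le> ?D" using False F.level_empty[of 1] by (fastforce simp: level)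
  \<comment> \<open>At \<open>i = 0\<close> the symmetry fails, but \<open>?h 0\<close> is 1 and
    level 1 is nonempty.\<close>
  have up: "?h i \<le> ?h (i + 1)" if "2 * i + 1 \<le> ?D" for i
  proof (cases "i = 0")
    case True
    have "0 < ?h 1" using False F.finite_level[of 1] by (simp add: level card_gt_0_iff del: One_nat_def)
    then show ?thesis using True by (simp add: level_0)
  qed (use F.card_level_mono[OF _ that] in \<open>simp add: level\<close>)
  \<comment> \<open>Reflection turns this into \<open>up\<close> at \<open>?D - (i + 1)\<close>.
    Beyond the reflected range the left side is 0.\<close>
  have down: "?h (i + 1) \<le> ?h i" if "?D \<le> 2 * i + 1" for i
  proof (cases "?D \<le> i + 1")
    case False
    have "?h (?D - (i + 1)) \<le> ?h (?D - (i + 1) + 1)" using that False by (intro up) auto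
    also have "?D - (i + 1) + 1 = ?D - i" using False by simp
    also have "?h (?D - i) = ?h i" using F.card_level_symmetric[of i] that False D2 by (simp add: level)
    also have "?h (?D - (i + 1)) = ?h (i + 1)"
      using F.card_level_symmetric[of "i + 1"] False by (simp add: level)
    finally show ?thesis .
  qed (simp add: empty)
  let ?a = "map (\<lambda>i. rat_of_nat (?h i)) [0..<d + 1]"
  have nth: "?a ! i = rat_of_nat (?h i)" if "i < d + 1" for i using that by (simp del: upt_Suc)
  show ?thesis
    unfolding hstar_vector_eq[OF dim] unimodal_def
  proof (intro exI[of _ "?D div 2"] conjI allI impI)
    show "?D div 2 < length ?a" using D D2 by simp
    show "?a ! i \<le> ?a ! Suc i" if "i < ?D div 2" for i
    proof -
      have "i < d + 1" "Suc i < d + 1" using that D D2 by auto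
      then show ?thesis using up[of i] that by (simp only: nth of_nat_le_iff) simp
    qed
    show "?a ! Suc i \<le> ?a ! i" if "?D div 2 \<le> i \<and> Suc i < length ?a" for i
    proof -
      have "i < d + 1" "Suc i < d + 1" using that by auto
      then show ?thesis using down[of i] that by (simp only: nth of_nat_le_iff) simp
    qed
  qed
qed

end

theorem theorem4p4:
  fixes M :: "'a::euclidean_space set" and v :: "nat \<Rightarrow> 'a" and d :: nat and \<Delta> :: "'a set"
  assumes "is_lattice M"
    and "\<Delta> = convex hull (v ` {0..d})"
    and "lattice_simplex M d \<Delta>"
    and "IDP M \<Delta>"
  shows "(full_support M v {0..d} \<longrightarrow> unimodal (hstar_vector M \<Delta>)) \<and>
         (normalized_volume M \<Delta> > 1 \<and> full_support M v (support_indices M v {0..d})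
            \<longrightarrow> unimodal (hstar_vector M \<Delta>))"
proof -
  note vertices = lattice_simplex_vertices[OF assms(2,3)]
  obtain \<kappa> :: "nat \<Rightarrow> 'a \<times> real \<Rightarrow> real" where \<kappa>: "\<And>j. linear (\<kappa> j)"
    "\<And>i j. i \<le> d \<Longrightarrow> j \<le> d \<Longrightarrow> \<kappa> i (v j, 1) = of_bool (i = j)"
    using barycentric_functionals[OF vertices(2,3)] by blast
  interpret simplex_coordinates M v d \<kappa>
    by (rule simplex_coordinates.intro) (use assms(1) vertices(4) \<kappa> in auto)
  \<comment> \<open>Both parts follow from this: take all indices for the first and the support
    indices for the second.\<close>
  have unimodal: "unimodal (hstar_vector M \<Delta>)"
    if J: "J \<subseteq> {0..d}" "full_support M v J" "\<And>p. p \<in> box \<Longrightarrow> p \<in> span (w ` J)" for J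
    unfolding assms(2)
    by (rule unimodal_hstar[OF _ _ J(1) support_eq_if_full_support[OF J(1,2) _ J(3)]])
       (use vertices(1) assms(2,4) in auto)
  have "support_indices M v {0..d} \<subseteq> {0..d}"
    by (auto simp: support_indices_def coord_supp_def)
  then show ?thesis
    using unimodal[of "{0..d}"] unimodal[of "support_indices M v {0..d}"] box_in_support_span box_span
    by blast
qed

end
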